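(* Fix nonempty totally ordered sets $X, Y$ and an integer $p \geq 1$. Fix $k_1, \dots, k_p, l \in \mathbb{Z}_{>0} \cup \{\infty\}$, and define $\mathcal{N} := \min\{|X|, |Y|, l\} \in \mathbb{Z}_{>0} \sqcup \{\infty\}$. Consider functions $F : [0,\infty)^p \to [0,\infty)$ satisfying the following property: $$(\ast)\qquad F \circ \mathbf{K} \in \mathrm{TN}^{(l)}_{X \times Y} \quad \text{whenever } \mathbf{K} = (K_1,\dots,K_p) \text{ with } K_j \in \mathrm{TN}^{(k_j)}_{X\times Y} \text{ for all } j \in [p].$$ 1. If $\mathcal{N} = 1$, then the maps $F$ satisfying $(\ast)$ are all functions $[0,\infty)^p \to [0,\infty)$. 2. If $\mathcal{N} = 2$, then $F : [0,\infty)^p \to [0,\infty)$ satisfies $(\ast)$ if and only if there exist a subset of indices $J \subseteq [p]$ and nonnegative constants $c$ and $\{\alpha_j : j \in J\}$ such that $$F(\mathbf{t}) = c \prod_{j \in J} t_j^{\alpha_j} \prod_{i \notin J} \mathbf{1}_{t_i > 0},$$ where moreover, if $k_j < \mathcal{N}$ for any $j \in [p]$, then $j \in J$ and $\alpha_j = 0$. 3. If $\mathcal{N} = 3$, then the functions $F$ satisfying $(\ast)$ are precisely the nonnegative constants and the individual powers $F(\mathbf{t}) = c\, t_j^{\alpha_j}$ for a single $j \in [p]$, with $c > 0$, $\alpha_j \geq 1$, and $k_j \geq \mathcal{N}$. 4. If $4 \leq \mathcal{N} \leq \infty$, then the functions $F$ satisfying $(\ast)$ are precisely the nonnegative constants and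 the homotheties $F(\mathbf{t}) = c\, t_j$ for a single $j \in [p]$, with $c > 0$ and $k_j \geq \mathcal{N}$.
   Context: For a positive integer $p$, $[p] := \{1,\dots,p\}$. Convention: $0^\alpha = 0$ if $\alpha > 0$, and $0^0 := 1$. $\mathbf{1}_{t>0}$ denotes the function equal to $1$ if $t>0$ and $0$ if $t=0$. $|X|$ is the number of elements of $X$, taken to be $\infty$ if $X$ is infinite. For a totally ordered set $X$ and integer $r\ge 1$, let $X^{r,\uparrow} := \{(x_1,\dots,x_r) \in X^r : x_1 < \cdots < x_r\}$. For a kernel $K : X \times Y \to [0,\infty)$, $\mathbf{x} \in X^{r,\uparrow}$ and $\mathbf{y} \in Y^{r,\uparrow}$, let $K[\mathbf{x};\mathbf{y}] := (K(x_i,y_j))_{i,j=1}^r$. For an integer $k \ge 1$, $K$ is totally nonnegative of order $k$, written $K \in \mathrm{TN}^{(k)}_{X\times Y}$, if $\det K[\mathbf{x};\mathbf{y}] \ge 0$ for all integers $1 \le r \le k$ and all $\mathbf{x} \in X^{r,\uparrow}$, $\mathbf{y} \in Y^{r,\uparrow}$. $K \in \mathrm{TN}^{(\infty)}_{X \times Y}$ means this holds for all integers $k\ge 1$. For $F : [0,\infty)^p \to [0,\infty)$ and a tuple $\mathbf{K} = (K_1,\dots,K_p)$ of kernels $K_j : X \times Y \to [0,\infty)$, $F \circ \mathbf{K}$ is the kernel $(x,y) \mapsto F(K_1(x,y),\dots,K_p(x,y))$. *)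

theory Defs
  imports
    Complex_Main
    "HOL-Library.Extended_Nat"
    "HOL-Library.FuncSet"
    "Jordan_Normal_Form.Determinant"
begin

definition ecard :: "'a set \<Rightarrow> enat" where
  "ecard X = (if finite X then enat (card X) else \<infinity>)"

text \<open>The strictly increasing r-tuples of elements of X, encoded as lists.\<close>

definition increasing_tuples :: "'a::linorder set \<Rightarrow> nat \<Rightarrow> 'a list set" where
  "increasing_tuples X r = {xs. length xs = r \<and> set xs \<subseteq> X \<and> sorted_wrt (<) xs}"

definition kernel_on :: "'a set \<Rightarrow> 'b set \<Rightarrow> ('a \<Rightarrow> 'b \<Rightarrow> real) \<Rightarrow> bool" where
  "kernel_on X Y K \<longleftrightarrow> (\<forall>x\<in>X. \<forall>y\<in>Y. 0 \<le> K x y)"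

definition kernel_mat :: "('a \<Rightarrow> 'b \<Rightarrow> real) \<Rightarrow> 'a list \<Rightarrow> 'b list \<Rightarrow> real mat" where
  "kernel_mat K xs ys = mat (length xs) (length ys) (\<lambda>(i, j). K (xs ! i) (ys ! j))"

text \<open>Since r ranges over the natural numbers, the order \<open>\<infinity>\<close> imposes the condition for every r.\<close>

definition TN :: "enat \<Rightarrow> 'a::linorder set \<Rightarrow> 'b::linorder set \<Rightarrow> ('a \<Rightarrow> 'b \<Rightarrow> real) set" where
  "TN k X Y = {K. kernel_on X Y K \<and>
     (\<forall>r::nat. 1 \<le> r \<and> enat r \<le> k \<longrightarrow>
        (\<forall>xs\<in>increasing_tuples X r. \<forall>ys\<in>increasing_tuples Y r. 0 \<le> det (kernel_mat K xs ys)))}"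

definition orthant :: "nat \<Rightarrow> (nat \<Rightarrow> real) set" where
  "orthant p = {1..p} \<rightarrow>\<^sub>E {0..}"

definition compose_kernels ::
    "nat \<Rightarrow> ((nat \<Rightarrow> real) \<Rightarrow> real) \<Rightarrow> (nat \<Rightarrow> 'a \<Rightarrow> 'b \<Rightarrow> real) \<Rightarrow> 'a \<Rightarrow> 'b \<Rightarrow> real" where
  "compose_kernels p F K = (\<lambda>x y. F (\<lambda>j\<in>{1..p}. K j x y))"

definition TN_preserver ::
    "nat \<Rightarrow> 'a::linorder set \<Rightarrow> 'b::linorder set \<Rightarrow> (nat \<Rightarrow> enat) \<Rightarrow> enat
      \<Rightarrow> ((nat \<Rightarrow> real) \<Rightarrow> real) \<Rightarrow> bool" where
  "TN_preserver p X Y k l F \<longleftrightarrow>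
     (\<forall>K. (\<forall>j\<in>{1..p}. K j \<in> TN (k j) X Y) \<longrightarrow> compose_kernels p F K \<in> TN l X Y)"

text \<open>Real powers with the convention that the zeroth power of 0 is 1
  (the library has \<open>0 powr 0 = 0\<close>).\<close>

definition rpow :: "real \<Rightarrow> real \<Rightarrow> real" where
  "rpow t \<alpha> = (if t = 0 \<and> \<alpha> = 0 then 1 else t powr \<alpha>)"

end

theory Submission
  imports Defs "HOL-Analysis.Convex" "HOL-Real_Asymp.Real_Asymp"
begin

text \<open>Total nonnegativity of order \<open>l\<close> on \<open>X \<times> Y\<close> involves only minors of size at most
\<open>N = min (ecard X) (min (ecard Y) l)\<close>, and conversely all matrices of such sizes occur: composing a
kernel with weakly monotone maps preserves total nonnegativity of every order, since a minor with a
repeated row or column vanishes, and a set with at least \<open>n\<close> elements maps monotonically onto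
\<open>{..<n}\<close>. So for each finite \<open>n \<le> N\<close> a preserver \<open>F\<close> on \<open>X \<times> Y\<close> must send \<open>n \<times> n\<close> matrices
that are totally nonnegative of orders \<open>k\<^sub>1, ..., k\<^sub>p\<close> to a matrix with nonnegative determinant
(lemma \<open>preserver_matrix\<close>). Necessity is obtained by
feeding suitable matrices to \<open>F\<close>.

\<^item> Size 2. \<open>F b * F c \<le> F a * F d\<close> holds as soon as \<open>b\<^sub>j c\<^sub>j \<le> a\<^sub>j d\<^sub>j\<close> for the \<open>j\<close> with \<open>k\<^sub>j \<ge> 2\<close>.
  Using this in both directions, \<open>F\<close> is either identically 0 or, after division by its value at
  \<open>(1, ..., 1)\<close>, multiplicative on the whole orthant, hence a product of monotone multiplicative functions of one variable. Each of them is
  a power or the indicator of \<open>t > 0\<close> (lemma \<open>product_form\<close>).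

\<^item> Size 3. Call a variable active if its factor vanishes at 0. Two active variables are excluded
  because entrywise products do not preserve total nonnegativity: there is a totally
  nonnegative 0/1 matrix whose product with its transpose has determinant \<open>-1\<close>. A single active
  variable has order at least 3 because that same product is totally nonnegative of order 2. A
  singular matrix with entries 0, 1, 2 forces the exponent to be at least 1
  (lemma \<open>preserver_3_power\<close>).

\<^item> Size 4. The singular matrices \<open>pencil x\<close> are totally nonnegative for all \<open>x > 0\<close>; for an exponent
  \<open>\<alpha> > 1\<close> the determinant of their entrywise powers is a negative multiple of \<open>x ^ 4\<close> to leading
  order (lemma \<open>pencil_powr_minor\<close>). So \<open>\<alpha> = 1\<close>. Finally, a homothety does not
  change the signs of the minors of its argument, and for each \<open>n \<ge> 2\<close> the tridiagonal matrix \<open>tri n\<close> is totally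
  nonnegative of every order below \<open>n\<close> but has negative determinant (lemmas \<open>tri_mem_TN\<close> and
  \<open>tri_det_neg\<close>), so the order of the remaining variable is at least \<open>N\<close>.

In the converse direction the only claim with substance is that entrywise powers with exponent
\<open>\<alpha> \<ge> 1\<close> preserve nonnegativity of the determinant of totally nonnegative \<open>3 \<times> 3\<close> matrices
(lemma \<open>powr_det3_nonneg\<close>). By Sylvester's identity this is an inequality between
\<open>2 \<times> 2\<close> minors of a Schur complement, and it follows from the multiplicative convexity of
\<open>m \<longmapsto> (m + u) powr \<alpha> - m powr \<alpha>\<close>.\<close>

section \<open>Minors of kernels\<close>

abbreviation minor :: "('a \<Rightarrow> 'b \<Rightarrow> real) \<Rightarrow> 'a list \<Rightarrow> 'b list \<Rightarrow> real" where
  "minor K xs ys \<equiv> det (kernel_mat K xs ys)"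

lemma minor_Nil [simp]: "minor K [] [] = 1"
  by (simp add: kernel_mat_def)

lemma minor_Cons:
  assumes "length ys = Suc (length xs)"
  shows "minor K (x # xs) ys =
    (\<Sum>j<length ys. (- 1) ^ j * K x (ys ! j) * minor K xs (take j ys @ drop (Suc j) ys))"
proof -
  let ?A = "kernel_mat K (x # xs) ys"
  have A: "?A \<in> carrier_mat (length ys) (length ys)"
    using assms by (simp add: kernel_mat_def)
  have "mat_delete ?A 0 j = kernel_mat K xs (take j ys @ drop (Suc j) ys)" if "j < length ys" for j
    using that assms by (intro eq_matI) (auto simp: mat_delete_def kernel_mat_def nth_append)
  then show ?thesis
    using assms by (subst laplace_expansion_row[OF A, of 0], simp)
      (intro sum.cong, auto simp: cofactor_def, auto simp: kernel_mat_def)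
qed

lemma minor_transpose:
  assumes "length xs = length ys"
  shows "minor (\<lambda>y x. K x y) ys xs = minor K xs ys"
proof -
  have "kernel_mat (\<lambda>y x. K x y) ys xs = transpose_mat (kernel_mat K xs ys)"
    by (intro eq_matI) (auto simp: kernel_mat_def)
  moreover have "kernel_mat K xs ys \<in> carrier_mat (length xs) (length xs)"
    using assms by (simp add: kernel_mat_def)
  ultimately show ?thesis
    by (metis det_transpose)
qed

lemma minor_cong:
  assumes "length xs = length ys"
    and "\<And>i j. i < length xs \<Longrightarrow> j < length ys \<Longrightarrow> K (xs ! i) (ys ! j) = L (xs' ! i) (ys' ! j)"
    and "length xs' = length xs" "length ys' = length ys"
  shows "minor K xs ys = minor L xs' ys'"
proof -
  have "kernel_mat K xs ys = kernel_mat L xs' ys'"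
    using assms by (intro eq_matI) (auto simp: kernel_mat_def)
  then show ?thesis by simp
qed

lemma minor_1: "minor K [x] [y] = K x y"
  by (simp add: minor_Cons)

lemma minor_2: "minor K [x1, x2] [y1, y2] = K x1 y1 * K x2 y2 - K x1 y2 * K x2 y1"
  by (simp add: minor_Cons minor_1 lessThan_Suc)

lemma minor_3: "minor K [x1, x2, x3] [y1, y2, y3] =
    K x1 y1 * (K x2 y2 * K x3 y3 - K x2 y3 * K x3 y2)
  - K x1 y2 * (K x2 y1 * K x3 y3 - K x2 y3 * K x3 y1)
  + K x1 y3 * (K x2 y1 * K x3 y2 - K x2 y2 * K x3 y1)"
  by (subst minor_Cons) (simp_all add: minor_2 lessThan_Suc numeral_eq_Suc)

lemma minor_4: "minor K [x1, x2, x3, x4] [y1, y2, y3, y4] =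
    K x1 y1 * minor K [x2, x3, x4] [y2, y3, y4]
  - K x1 y2 * minor K [x2, x3, x4] [y1, y3, y4]
  + K x1 y3 * minor K [x2, x3, x4] [y1, y2, y4]
  - K x1 y4 * minor K [x2, x3, x4] [y1, y2, y3]"
  by (subst minor_Cons) (simp_all add: lessThan_Suc numeral_eq_Suc)

lemma minor_first_row_single:
  assumes "length xs = length ys" and "\<And>y'. y' \<in> set ys \<Longrightarrow> K x y' = 0"
  shows "minor K (x # xs) (y # ys) = K x y * minor K xs ys"
  by (subst minor_Cons) (simp_all only: assms length_Cons sum.lessThan_Suc_shift, simp add: assms nth_mem)

lemma minor_first_column_single:
  assumes "length xs = length ys" and "\<And>x'. x' \<in> set xs \<Longrightarrow> K x' y = 0"
  shows "minor K (x # xs) (y # ys) = K x y * minor K xs ys"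
proof -
  have "minor (\<lambda>y x. K x y) (y # ys) (x # xs) = K x y * minor (\<lambda>y x. K x y) ys xs"
    using assms by (intro minor_first_row_single) auto
  then show ?thesis using minor_transpose[of "x # xs" "y # ys" K] minor_transpose[of xs ys K] assms(1) by simp
qed

text \<open>The form taken by the expansion of a tridiagonal minor whose row and column indices start with the same two
consecutive numbers.\<close>
lemma minor_first_row_double:
  assumes "length xs = Suc (length ys)" and "\<And>z. z \<in> set ys \<Longrightarrow> K x z = 0"
  shows "minor K (x # xs) (y # y' # ys) = K x y * minor K xs (y' # ys) - K x y' * minor K xs (y # ys)"
  by (subst minor_Cons) (simp_all only: assms length_Cons sum.lessThan_Suc_shift, simp add: assms nth_mem)

lemma minor_equal_rows:
  assumes "length xs = length ys" "i < length xs" "j < length xs" "i \<noteq> j"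
    and "\<And>y. y \<in> set ys \<Longrightarrow> K (xs ! i) y = K (xs ! j) y"
  shows "minor K xs ys = 0"
proof (rule det_identical_rows[of _ "length xs" i j])
  show "row (kernel_mat K xs ys) i = row (kernel_mat K xs ys) j"
    using assms(1-3) by (intro eq_vecI) (auto simp: kernel_mat_def intro!: assms(5))
qed (use assms(1-4) in \<open>auto simp: kernel_mat_def\<close>)

lemma minor_equal_columns:
  assumes "length xs = length ys" "i < length ys" "j < length ys" "i \<noteq> j"
    and "\<And>x. x \<in> set xs \<Longrightarrow> K x (ys ! i) = K x (ys ! j)"
  shows "minor K xs ys = 0"
proof -
  have "minor (\<lambda>y x. K x y) ys xs = 0"
    by (rule minor_equal_rows[of _ _ i j]) (use assms(1) in simp, fact assms(2), fact assms(3), fact assms(4), fact assms(5))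
  then show ?thesis using minor_transpose[OF assms(1), of K] by simp
qed

lemma minor_scale:
  assumes "length xs = length ys"
  shows "minor (\<lambda>x y. c * K x y) xs ys = c ^ length xs * minor K xs ys"
proof -
  have "kernel_mat (\<lambda>x y. c * K x y) xs ys = c \<cdot>\<^sub>m kernel_mat K xs ys"
    by (intro eq_matI) (auto simp: kernel_mat_def)
  then show ?thesis using assms by (simp add: kernel_mat_def)
qed

section \<open>Total nonnegativity and pullbacks\<close>

lemma increasing_tuplesD:
  assumes "xs \<in> increasing_tuples X r"
  shows "length xs = r" "set xs \<subseteq> X" "sorted_wrt (<) xs" "distinct xs" "enat r \<le> ecard X"
proof -
  show *: "length xs = r" "set xs \<subseteq> X" "sorted_wrt (<) xs"
    using assms by (auto simp: increasing_tuples_def)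
  then show d: "distinct xs" by (simp add: strict_sorted_iff)
  show "enat r \<le> ecard X"
    using * d by (auto simp: ecard_def) (metis card_mono distinct_card)
qed

text \<open>Minors of size 1 are entries, and there is no increasing tuple longer than the set it is taken from,
so only sizes between 2 and the minimum of the three bounds remain.\<close>
lemma TN_memI:
  assumes "kernel_on X Y K"
    and "\<And>r xs ys. 2 \<le> r \<Longrightarrow> enat r \<le> min (ecard X) (min (ecard Y) k) \<Longrightarrow>
      xs \<in> increasing_tuples X r \<Longrightarrow> ys \<in> increasing_tuples Y r \<Longrightarrow> 0 \<le> minor K xs ys"
  shows "K \<in> TN k X Y"
proof -
  have "0 \<le> minor K xs ys"
    if "1 \<le> r" "enat r \<le> k" and xs: "xs \<in> increasing_tuples X r" and ys: "ys \<in> increasing_tuples Y r"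
    for r xs ys
  proof (cases "r = 1")
    case True
    then obtain x y where "xs = [x]" "ys = [y]"
      using xs ys by (auto simp: increasing_tuples_def length_Suc_conv)
    moreover have "x \<in> X" "y \<in> Y"
      using xs ys calculation by (auto simp: increasing_tuples_def)
    ultimately show ?thesis
      using assms(1) by (simp add: minor_1 kernel_on_def)
  next
    case False
    then show ?thesis
      using assms(2)[of r xs ys] that increasing_tuplesD(5)[OF xs] increasing_tuplesD(5)[OF ys] by auto
  qed
  then show ?thesis using assms(1) unfolding TN_def by blast
qed

lemma TN_minor_nonneg:
  assumes "K \<in> TN k X Y" "xs \<in> increasing_tuples X r" "ys \<in> increasing_tuples Y r" "enat r \<le> k"
  shows "0 \<le> minor K xs ys"
proof (cases "r = 0")
  case True
  then have "xs = []" "ys = []" using assms by (auto simp: increasing_tuples_def)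
  then show ?thesis by simp
next
  case False
  then have "1 \<le> r" by simp
  then show ?thesis using assms unfolding TN_def by blast
qed

lemma TN_nonneg: "K \<in> TN k X Y \<Longrightarrow> x \<in> X \<Longrightarrow> y \<in> Y \<Longrightarrow> 0 \<le> K x y"
  by (simp add: TN_def kernel_on_def)

lemma TN_transpose: "K \<in> TN k X Y \<Longrightarrow> (\<lambda>y x. K x y) \<in> TN k Y X"
  unfolding TN_def kernel_on_def by (auto, metis increasing_tuplesD(1) minor_transpose)

lemma increasing_tuples_mono_map:
  assumes "xs \<in> increasing_tuples X r" "mono_on X f" "f ` X \<subseteq> X'" "distinct (map f xs)"
  shows "map f xs \<in> increasing_tuples X' r"
proof -
  note xs = increasing_tuplesD[OF assms(1)]
  have "sorted (map f xs)"
    unfolding sorted_wrt_map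
    using sorted_wrt_mono_rel[OF _ xs(3), of "\<lambda>x y. f x \<le> f y"] assms(2) xs(2)
    by (meson monotone_onD order_less_imp_le subsetD)
  then have "sorted_wrt (<) (map f xs)" using assms(4) by (simp add: strict_sorted_iff)
  then show ?thesis using xs assms(3) by (auto simp: increasing_tuples_def)
qed

text \<open>The maps need not be injective: where one of them identifies two members of a tuple, the minor has two
equal rows or columns. This is how small matrices are extended to kernels on all of \<open>X \<times> Y\<close>.\<close>
lemma TN_pullback:
  assumes K: "K \<in> TN k X' Y'"
    and f: "mono_on X f" "f ` X \<subseteq> X'" and g: "mono_on Y g" "g ` Y \<subseteq> Y'"
  shows "(\<lambda>x y. K (f x) (g y)) \<in> TN k X Y"
proof (rule TN_memI)
  show "kernel_on X Y (\<lambda>x y. K (f x) (g y))"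
    using K f(2) g(2) by (auto simp: TN_def kernel_on_def image_subset_iff)
next
  fix r xs ys
  assume r: "enat r \<le> min (ecard X) (min (ecard Y) k)"
    and xs: "xs \<in> increasing_tuples X r" and ys: "ys \<in> increasing_tuples Y r"
  note l = increasing_tuplesD(1)[OF xs] increasing_tuplesD(1)[OF ys]
  let ?L = "\<lambda>x y. K (f x) (g y)"
  show "0 \<le> minor ?L xs ys"
  proof (cases "distinct (map f xs) \<and> distinct (map g ys)")
    case True
    then have "0 \<le> minor K (map f xs) (map g ys)"
      using increasing_tuples_mono_map[OF xs f] increasing_tuples_mono_map[OF ys g] r
      by (intro TN_minor_nonneg[OF K]) auto
    also have "\<dots> = minor ?L xs ys"
      using l by (intro minor_cong) auto
    finally show ?thesis .
  next
    case False
    then consider i j where "i < length xs" "j < length xs" "i \<noteq> j" "f (xs ! i) = f (xs ! j)"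
      | i j where "i < length ys" "j < length ys" "i \<noteq> j" "g (ys ! i) = g (ys ! j)"
      by (auto simp: distinct_conv_nth)
    then show ?thesis
    proof cases
      case 1
      have "minor ?L xs ys = 0" by (rule minor_equal_rows[of _ _ i j]) (use 1 l in auto)
      then show ?thesis by simp
    next
      case 2
      have "minor ?L xs ys = 0" by (rule minor_equal_columns[of _ _ i j]) (use 2 l in auto)
      then show ?thesis by simp
    qed
  qed
qed

text \<open>For an increasing tuple \<open>x\<^sub>0 < ... < x\<^sub>n\<^sub>-\<^sub>1\<close> the map counts the \<open>i \<ge> 1\<close> with
\<open>x\<^sub>i \<le> x\<close>; index 0 is left out so that points below \<open>x\<^sub>0\<close> are sent to 0.\<close>
lemma monotone_onto_initial_segment:
  fixes X :: "'a::linorder set"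
  assumes "enat n \<le> ecard X" "1 \<le> n"
  obtains f :: "'a \<Rightarrow> nat" and xs where "mono_on X f" "f ` X \<subseteq> {..<n}"
    "xs \<in> increasing_tuples X n" "map f xs = [0..<n]"
proof -
  obtain S where S: "S \<subseteq> X" "finite S" "card S = n"
  proof (cases "finite X")
    case True
    then have "n \<le> card X" using assms by (simp add: ecard_def)
    then show ?thesis using that by (meson obtain_subset_with_card_n)
  next
    case False
    then show ?thesis using that infinite_arbitrarily_large by blast
  qed
  define xs where "xs = sorted_list_of_set S"
  have xs: "length xs = n" "set xs = S" "sorted_wrt (<) xs"
    using S by (auto simp: xs_def strict_sorted_iff)
  define f where "f x = card {i. 1 \<le> i \<and> i < n \<and> xs ! i \<le> x}" for x
  have f: "f x \<le> f y" if "x \<le> y" for x y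
    unfolding f_def using that by (intro card_mono) auto
  have f2: "f x < n" for x
  proof -
    have "f x \<le> card {1..<n}" unfolding f_def by (intro card_mono) auto
    then show ?thesis using assms(2) by simp
  qed
  have "f (xs ! j) = j" if "j < n" for j
  proof -
    have "xs ! i \<le> xs ! j \<longleftrightarrow> i \<le> j" if "i < n" for i
      using sorted_wrt_nth_less[OF xs(3), of i j] sorted_wrt_nth_less[OF xs(3), of j i] that \<open>j < n\<close> xs(1)
      by (metis leD le_less linorder_less_linear)
    then have "{i. 1 \<le> i \<and> i < n \<and> xs ! i \<le> xs ! j} = {1..j}"
      using that by auto
    then show ?thesis by (simp add: f_def)
  qed
  then have "map f xs = [0..<n]" using xs by (intro nth_equalityI) auto
  moreover have "xs \<in> increasing_tuples X n"
    using xs S(1) by (auto simp: increasing_tuples_def)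
  moreover have "mono_on X f" using f by (auto intro: mono_onI)
  moreover have "f ` X \<subseteq> {..<n}" using f2 by auto
  ultimately show ?thesis using that by blast
qed

text \<open>The source of all necessary conditions: pull the matrices back to \<open>X \<times> Y\<close> along monotone surjections and
read off the minor at preimages of \<open>0, ..., n - 1\<close>.\<close>
lemma preserver_matrix:
  fixes A :: "nat \<Rightarrow> nat \<Rightarrow> nat \<Rightarrow> real"
  assumes F: "TN_preserver p X Y k l F" and n: "enat n \<le> min (ecard X) (min (ecard Y) l)" "1 \<le> n"
    and A: "\<And>j. j \<in> {1..p} \<Longrightarrow> A j \<in> TN (k j) {..<n} {..<n}"
  shows "0 \<le> minor (\<lambda>a b. F (\<lambda>j\<in>{1..p}. A j a b)) [0..<n] [0..<n]"
proof -
  obtain f xs where f: "mono_on X f" "f ` X \<subseteq> {..<n}" "xs \<in> increasing_tuples X n" "map f xs = [0..<n]"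
    using monotone_onto_initial_segment[of n X] n by auto
  obtain g ys where g: "mono_on Y g" "g ` Y \<subseteq> {..<n}" "ys \<in> increasing_tuples Y n" "map g ys = [0..<n]"
    using monotone_onto_initial_segment[of n Y] n by auto
  define K where "K j x y = A j (f x) (g y)" for j x y
  have "compose_kernels p F K \<in> TN l X Y"
  proof -
    have "\<forall>j\<in>{1..p}. K j \<in> TN (k j) X Y"
      unfolding K_def using TN_pullback[OF A f(1,2) g(1,2)] by simp
    then show ?thesis using F unfolding TN_preserver_def by simp
  qed
  then have "0 \<le> minor (compose_kernels p F K) xs ys"
    using TN_minor_nonneg f(3) g(3) n by fastforce
  also have "minor (compose_kernels p F K) xs ys = minor (\<lambda>a b. F (\<lambda>j\<in>{1..p}. A j a b)) (map f xs) (map g ys)"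
    using increasing_tuplesD(1)[OF f(3)] increasing_tuplesD(1)[OF g(3)]
    by (intro minor_cong) (auto simp: compose_kernels_def K_def)
  finally show ?thesis using f(4) g(4) by simp
qed

section \<open>Domination on pairs and multiplicativity\<close>

text \<open>Additivity gives linearity at integers, and monotonicity squeezes \<open>n * h x\<close> between
consecutive multiples of \<open>h 1\<close>, so that \<open>n * \<bar>h x - h 1 * x\<bar>\<close> stays bounded in \<open>n\<close>.\<close>
lemma additive_mono_is_linear:
  fixes h :: "real \<Rightarrow> real"
  assumes add: "\<And>x y. h (x + y) = h x + h y" and mono: "mono h"
  shows "h x = h 1 * x"
proof -
  have nat: "h (of_nat n * y) = of_nat n * h y" for n y
  proof (induction n)
    case 0
    then show ?case using add[of 0 0] by simp
  next
    case (Suc n)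
    then show ?case using add[of "of_nat n * y" y] by (simp add: algebra_simps)
  qed
  have neg: "h (- y) = - h y" for y
    using add[of "- y" y] add[of 0 0] by simp
  have int: "h (of_int m * y) = of_int m * h y" for m y
    by (cases m rule: int_cases2) (use nat neg in \<open>auto simp: algebra_simps\<close>)
  have pos: "0 \<le> h 1"
    using monoD[OF mono, of 0 1] add[of 0 0] by simp
  have "of_nat n * \<bar>h x - h 1 * x\<bar> \<le> h 1" for n :: nat
  proof -
    let ?m = "\<lfloor>of_nat n * x\<rfloor>"
    have "h (of_int ?m * 1) \<le> h (of_nat n * x)" "h (of_nat n * x) \<le> h (of_int (?m + 1) * 1)"
      using floor_correct[of "of_nat n * x"] by (auto intro!: monoD[OF mono])
    then have "of_int ?m * h 1 \<le> of_nat n * h x" "of_nat n * h x \<le> of_int (?m + 1) * h 1"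
      unfolding int nat .
    moreover have "of_int ?m * h 1 \<le> (of_nat n * x) * h 1" "(of_nat n * x) * h 1 \<le> of_int (?m + 1) * h 1"
      using pos by (intro mult_right_mono; linarith)+
    ultimately have "\<bar>of_nat n * h x - (of_nat n * x) * h 1\<bar> \<le> h 1"
      by (simp add: algebra_simps abs_le_iff)
    also have "of_nat n * h x - (of_nat n * x) * h 1 = of_nat n * (h x - h 1 * x)"
      by (simp add: algebra_simps)
    finally show ?thesis by (simp add: abs_mult)
  qed
  then have "\<not> 0 < \<bar>h x - h 1 * x\<bar>"
    using reals_Archimedean3 by (metis not_le)
  then show ?thesis by simp
qed

text \<open>If \<open>g 0\<close> is nonzero, then \<open>g 0 = g 0 * g t\<close> makes \<open>g\<close> constant. Otherwise
\<open>g\<close> is positive on positive reals and \<open>ln \<circ> g \<circ> exp\<close> is additive and monotone. Exponent 0 with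
\<open>g 0 = 0\<close> is the indicator, which differs from \<open>rpow t 0\<close> exactly at 0.\<close>
lemma multiplicative_mono_cases:
  fixes g :: "real \<Rightarrow> real"
  assumes mult: "\<And>s t. 0 \<le> s \<Longrightarrow> 0 \<le> t \<Longrightarrow> g (s * t) = g s * g t"
    and mono: "\<And>s t. 0 \<le> s \<Longrightarrow> s \<le> t \<Longrightarrow> g s \<le> g t"
    and nonneg: "\<And>t. 0 \<le> t \<Longrightarrow> 0 \<le> g t" and one: "g 1 = 1"
  shows "\<exists>\<alpha>\<ge>0. (\<forall>t\<ge>0. g t = rpow t \<alpha>) \<or> (\<forall>t\<ge>0. g t = (if 0 < t then 1 else 0))"
proof (cases "g 0 = 0")
  case False
  have "g t = 1" if "0 \<le> t" for t
    using mult[of 0 t] that False by simp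
  then have "\<forall>t\<ge>0. g t = rpow t 0" by (simp add: rpow_def)
  then show ?thesis by blast
next
  case True
  have pos: "0 < g t" if "0 < t" for t
    using mult[of t "1/t"] nonneg[of t] one that by (cases "g t = 0") auto
  define h where "h x = ln (g (exp x))" for x
  have "h x = h 1 * x" for x
  proof (rule additive_mono_is_linear)
    show "h (x + y) = h x + h y" for x y
      using pos[of "exp x"] pos[of "exp y"] by (simp add: h_def exp_add mult ln_mult)
    show "mono h"
      using pos mono by (intro monoI) (simp add: h_def)
  qed
  then have "ln (g t) = h 1 * ln t" if "0 < t" for t
    using that by (metis h_def exp_ln)
  then have g: "g t = t powr h 1" if "0 < t" for t
    using pos[OF that] that by (metis exp_ln powr_def less_irrefl)
  have h1: "0 \<le> h 1"
    using mono[of 1 "exp 1"] one by (simp add: h_def)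
  show ?thesis
  proof (cases "h 1 = 0")
    case True
    then show ?thesis using g \<open>g 0 = 0\<close> by (intro exI[of _ 0]) auto
  next
    case False
    then show ?thesis using g h1 \<open>g 0 = 0\<close> by (intro exI[of _ "h 1"] conjI disjI1 allI impI) (auto simp: rpow_def le_less)
  qed
qed

lemma orthant_nonneg: "t \<in> orthant p \<Longrightarrow> j \<in> {1..p} \<Longrightarrow> 0 \<le> t j"
  by (auto simp: orthant_def PiE_def)

lemma orthant_restrict: "(\<And>j. j \<in> {1..p} \<Longrightarrow> 0 \<le> f j) \<Longrightarrow> (\<lambda>j\<in>{1..p}. f j) \<in> orthant p"
  by (auto simp: orthant_def)

lemma orthant_eq_restrict: "t \<in> orthant p \<Longrightarrow> (\<lambda>j\<in>{1..p}. t j) = t"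
  by (auto simp: orthant_def PiE_restrict)

text \<open>The domination hypothesis is an inequality, but when \<open>b\<^sub>j c\<^sub>j = a\<^sub>j d\<^sub>j\<close> on \<open>S\<close> it can be applied in
both directions; comparing \<open>(a, d)\<close> with \<open>(a d, 1)\<close> makes \<open>F\<close> multiplicative up to the factor
\<open>F (1, ..., 1)\<close>. The set \<open>S\<close> collects the coordinates on which \<open>F\<close> may depend:
the other coordinates can be changed at will in the hypothesis, so \<open>F\<close> is constant in them.\<close>
lemma product_form:
  fixes F :: "(nat \<Rightarrow> real) \<Rightarrow> real"
  assumes F_nonneg: "\<forall>t\<in>orthant p. 0 \<le> F t"
    and F_dom: "\<forall>a\<in>orthant p. \<forall>b\<in>orthant p. \<forall>c\<in>orthant p. \<forall>d\<in>orthant p.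
         (\<forall>j\<in>S. b j * c j \<le> a j * d j) \<longrightarrow> F b * F c \<le> F a * F d"
    and S: "S \<subseteq> {1..p}"
  shows "\<exists>J\<subseteq>{1..p}. \<exists>c\<ge>0. \<exists>\<alpha> :: nat \<Rightarrow> real.
            (\<forall>j\<in>J. 0 \<le> \<alpha> j) \<and>
            (\<forall>t\<in>orthant p. F t =
               c * (\<Prod>j\<in>J. rpow (t j) (\<alpha> j)) * (\<Prod>i\<in>{1..p} - J. if 0 < t i then 1 else 0)) \<and>
            (\<forall>j\<in>{1..p} - S. j \<in> J \<and> \<alpha> j = 0)"
proof -
  have nonneg: "0 \<le> F t" if "t \<in> orthant p" for t using F_nonneg that by simp
  have dom: "F b * F c \<le> F a * F d"
    if "a \<in> orthant p" "b \<in> orthant p" "c \<in> orthant p" "d \<in> orthant p"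
      "\<And>j. j \<in> S \<Longrightarrow> b j * c j \<le> a j * d j" for a b c d
    using F_dom that by simp
  define e :: "nat \<Rightarrow> real" where "e = (\<lambda>j\<in>{1..p}. 1)"
  have e: "e \<in> orthant p" unfolding e_def by (rule orthant_restrict) simp
  define pr where "pr a d = (\<lambda>j\<in>{1..p}. a j * d j)" for a d :: "nat \<Rightarrow> real"
  have pr: "pr a d \<in> orthant p" if "a \<in> orthant p" "d \<in> orthant p" for a d
    unfolding pr_def using that by (intro orthant_restrict) (simp add: orthant_nonneg)
  have mult: "F (pr a d) * F e = F a * F d" if "a \<in> orthant p" "d \<in> orthant p" for a d
    by (rule antisym; rule dom) (use that e pr S in \<open>auto simp: pr_def e_def subset_iff\<close>)
  have mono: "F b * F e \<le> F a * F e" if "a \<in> orthant p" "b \<in> orthant p" "\<And>j. j \<in> S \<Longrightarrow> b j \<le> a j" for a b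
    by (rule dom) (use that e S in \<open>auto simp: e_def subset_iff\<close>)
  show ?thesis
  proof (cases "F e = 0")
    case True
    have "F t = 0" if t: "t \<in> orthant p" for t
    proof -
      \<comment> \<open>The pair \<open>(t, t)\<close> is dominated by \<open>(v, v)\<close>, and \<open>F v * F v = F (v * v) * F e = 0\<close>.\<close>
      define v where "v = (\<lambda>j\<in>{1..p}. t j + 1)"
      have v: "v \<in> orthant p" unfolding v_def using t by (intro orthant_restrict) (simp add: orthant_nonneg)
      have "F t * F t \<le> F v * F v"
        by (rule dom) (use t v S in \<open>auto simp: v_def subset_iff orthant_nonneg intro!: mult_mono\<close>)
      also have "\<dots> = 0" using mult[OF v v] True by simp
      finally show ?thesis by (auto simp: mult_le_0_iff intro: antisym)
    qed
    then show ?thesis by (intro exI[of _ "{1..p}"] exI[of _ 0] exI[of _ "\<lambda>_. 0"] conjI) auto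
  next
    case False
    then have c: "0 < F e" using nonneg[OF e] by simp
    define G where "G t = F t / F e" for t
    have F: "F t = F e * G t" for t using False by (simp add: G_def)
    have Gmult: "G (pr a d) = G a * G d" if "a \<in> orthant p" "d \<in> orthant p" for a d
      using mult[OF that] False by (simp add: G_def field_simps)
    have Gmono: "G b \<le> G a" if "a \<in> orthant p" "b \<in> orthant p" "\<And>j. j \<in> S \<Longrightarrow> b j \<le> a j" for a b
      using mono[OF that] c by (simp add: G_def divide_right_mono)
    have Gnonneg: "0 \<le> G t" if "t \<in> orthant p" for t
      using nonneg[OF that] c by (simp add: G_def)
    \<comment> \<open>The vector with \<open>s\<close> in coordinate \<open>j\<close> and 1 elsewhere; a point of the orthant is the product of these.\<close>
    define u where "u j s = (\<lambda>i\<in>{1..p}. if i = j then s else 1 :: real)" for j s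
    have u: "u j s \<in> orthant p" if "0 \<le> s" for j s
      unfolding u_def using that by (intro orthant_restrict) simp
    define g where "g j s = G (u j s)" for j s
    have g1: "g j 1 = 1" for j
    proof -
      have "u j 1 = e" by (auto simp: u_def e_def)
      then show ?thesis using False by (simp add: g_def G_def)
    qed
    have gmono: "g j s \<le> g j t" if "0 \<le> s" "s \<le> t \<or> j \<notin> S" "0 \<le> t" for j s t
      unfolding g_def by (rule Gmono) (use that u S in \<open>auto simp: u_def subset_iff\<close>)
    have gmult: "g j (s * t) = g j s * g j t" if "0 \<le> s" "0 \<le> t" for j s t
    proof -
      have "u j (s * t) = pr (u j s) (u j t)" by (auto simp: u_def pr_def)
      then show ?thesis using u that by (simp add: g_def Gmult)
    qed
    have G: "G t = (\<Prod>j\<in>{1..p}. g j (t j))" if t: "t \<in> orthant p" for t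
    proof -
      have "A \<subseteq> {1..p} \<Longrightarrow> G (\<lambda>i\<in>{1..p}. if i \<in> A then t i else 1) = (\<Prod>j\<in>A. g j (t j))" if "finite A" for A
        using that
      proof (induction A rule: finite_induct)
        case empty
        have "(\<lambda>i\<in>{1..p}. if i \<in> {} then t i else 1) = e" by (simp add: e_def)
        then show ?case using False by (simp only: G_def prod.empty) simp
      next
        case (insert j A)
        let ?w = "\<lambda>A. (\<lambda>i\<in>{1..p}. if i \<in> A then t i else 1)"
        have tj: "0 \<le> t j" using t insert.prems by (simp add: orthant_nonneg)
        have w: "?w A \<in> orthant p"
          using t by (intro orthant_restrict) (simp add: orthant_nonneg)
        have "?w (insert j A) = pr (u j (t j)) (?w A)"
          using insert.hyps insert.prems by (auto simp: pr_def u_def)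
        then have "G (?w (insert j A)) = g j (t j) * G (?w A)"
          using Gmult[OF u[OF tj] w] unfolding g_def by simp
        also have "G (?w A) = (\<Prod>j\<in>A. g j (t j))"
          using insert.IH insert.prems by blast
        also have "g j (t j) * (\<Prod>j\<in>A. g j (t j)) = (\<Prod>j\<in>insert j A. g j (t j))"
          using insert.hyps by simp
        finally show ?case .
      qed
      from this[of "{1..p}"] show ?thesis
        using orthant_eq_restrict[OF t] by (simp cong: restrict_cong)
    qed
    define Q where "Q j \<alpha> \<longleftrightarrow> 0 \<le> \<alpha> \<and>
        ((\<forall>t\<ge>0. g j t = rpow t \<alpha>) \<or> (\<forall>t\<ge>0. g j t = (if 0 < t then 1 else 0))) \<and>
        (j \<notin> S \<longrightarrow> \<alpha> = 0 \<and> (\<forall>t\<ge>0. g j t = rpow t \<alpha>))" for j \<alpha>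
    have "\<exists>\<alpha>. Q j \<alpha>" for j
    proof (cases "j \<in> S")
      case True
      have "\<exists>\<alpha>\<ge>0. (\<forall>t\<ge>0. g j t = rpow t \<alpha>) \<or> (\<forall>t\<ge>0. g j t = (if 0 < t then 1 else 0))"
      proof (rule multiplicative_mono_cases)
        show "g j s \<le> g j t" if "0 \<le> s" "s \<le> t" for s t
          using gmono[where j = j and s = s and t = t] that by simp
        show "0 \<le> g j t" if "0 \<le> t" for t
          unfolding g_def using that by (intro Gnonneg u)
        show "g j (s * t) = g j s * g j t" if "0 \<le> s" "0 \<le> t" for s t
          by (rule gmult[OF that])
        show "g j 1 = 1" by (rule g1)
      qed
      then show ?thesis using True unfolding Q_def by blast
    next
      case False
      then have "g j t = 1" if "0 \<le> t" for t
        using gmono[where j = j and s = t and t = 1] gmono[where j = j and s = 1 and t = t] g1 that by (intro antisym) auto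
      then show ?thesis using False by (intro exI[of _ 0]) (auto simp: Q_def rpow_def)
    qed
    then have "\<exists>\<alpha>. \<forall>j. Q j (\<alpha> j)"
      by (intro choice allI)
    then obtain \<alpha> where "\<forall>j. Q j (\<alpha> j)" ..
    then have \<alpha>: "Q j (\<alpha> j)" for j by (rule spec)
    define J where "J = {j \<in> {1..p}. \<forall>t\<ge>0. g j t = rpow t (\<alpha> j)}"
    have J: "J \<subseteq> {1..p}" by (auto simp: J_def)
    have "F t = F e * (\<Prod>j\<in>J. rpow (t j) (\<alpha> j)) * (\<Prod>i\<in>{1..p} - J. if 0 < t i then 1 else 0)"
      if t: "t \<in> orthant p" for t
    proof -
      have "G t = (\<Prod>j\<in>J. g j (t j)) * (\<Prod>i\<in>{1..p} - J. g i (t i))"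
        unfolding G[OF t] using J prod.subset_diff[of J "{1..p}"] by (simp add: mult.commute)
      also have "(\<Prod>j\<in>J. g j (t j)) = (\<Prod>j\<in>J. rpow (t j) (\<alpha> j))"
        by (rule prod.cong) (use t orthant_nonneg in \<open>auto simp: J_def\<close>)
      also have "(\<Prod>i\<in>{1..p} - J. g i (t i)) = (\<Prod>i\<in>{1..p} - J. if 0 < t i then 1 else 0)"
      proof (rule prod.cong[OF refl])
        fix i assume i: "i \<in> {1..p} - J"
        then have "\<forall>s\<ge>0. g i s = (if 0 < s then 1 else 0)" using \<alpha>[of i] by (auto simp: J_def Q_def)
        then show "g i (t i) = (if 0 < t i then 1 else 0)" using i t orthant_nonneg[of t p i] by simp
      qed
      finally show ?thesis by (subst F) (simp only: mult.assoc)
    qed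
    then show ?thesis
      using \<alpha> J c by (intro exI[of _ J] conjI exI[of _ "F e"] exI[of _ \<alpha>]) (auto simp: J_def Q_def less_imp_le)
  qed
qed

section \<open>Entrywise powers of matrices of size 3\<close>

text \<open>Slopes of secants of the convex function \<open>z powr \<alpha>\<close> towards the point 1 increase, written
without division.\<close>
lemma powr_secant_slope_mono:
  fixes \<alpha> z1 z2 :: real
  assumes "1 \<le> \<alpha>" "0 < z1" "z1 \<le> z2" "z2 < 1"
  shows "(1 - z2) * (1 - z1 powr \<alpha>) \<le> (1 - z1) * (1 - z2 powr \<alpha>)"
proof -
  define t where "t = (z2 - z1) / (1 - z1)"
  have t: "0 \<le> t" "t \<le> 1" using assms by (auto simp: t_def field_simps)
  have t_eq: "(1 - z1) * t = z2 - z1" using assms by (simp add: t_def)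
  then have z2: "z2 = (1 - t) * z1 + t * 1" by (simp add: algebra_simps)
  have "z2 powr \<alpha> \<le> (1 - t) * z1 powr \<alpha> + t * 1 powr \<alpha>"
    using convex_onD[OF powr_convex[OF assms(1)], of t z1 1] t assms by (subst z2) simp
  then have "(1 - z1) * z2 powr \<alpha> \<le> (1 - z1) * ((1 - t) * z1 powr \<alpha> + t)"
    using assms by (intro mult_left_mono) auto
  also have "\<dots> = ((1 - z1) - (1 - z1) * t) * z1 powr \<alpha> + (1 - z1) * t"
    by (simp add: algebra_simps)
  also have "\<dots> = (1 - z2) * z1 powr \<alpha> + (z2 - z1)"
    unfolding t_eq by simp
  finally show ?thesis by (simp add: algebra_simps)
qed

text \<open>With \<open>m\<close> an entry of a matrix of rank one and \<open>m + u\<close> the corresponding entry of a given matrix, these are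
the entries of the difference after taking entrywise powers. They are studied as functions of \<open>m\<close>.\<close>
definition powr_gap :: "real \<Rightarrow> real \<Rightarrow> real \<Rightarrow> real" where
  "powr_gap \<alpha> u m = (m + u) powr \<alpha> - m powr \<alpha>"

lemma powr_gap_pos: "0 < \<alpha> \<Longrightarrow> 0 < u \<Longrightarrow> 0 \<le> m \<Longrightarrow> 0 < powr_gap \<alpha> u m"
  by (simp add: powr_gap_def powr_less_mono2)

lemma powr_gap_nonneg: "0 < \<alpha> \<Longrightarrow> 0 \<le> u \<Longrightarrow> 0 \<le> m \<Longrightarrow> 0 \<le> powr_gap \<alpha> u m"
  by (simp add: powr_gap_def powr_mono2)

lemma powr_gap_scale:
  "0 \<le> c \<Longrightarrow> 0 \<le> u \<Longrightarrow> 0 \<le> m \<Longrightarrow> powr_gap \<alpha> (c * u) (c * m) = c powr \<alpha> * powr_gap \<alpha> u m"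
  by (simp add: powr_gap_def powr_mult algebra_simps flip: distrib_left)

lemma powr_gap_deriv:
  assumes "0 < u" "0 < m"
  shows "(powr_gap \<alpha> u has_real_derivative \<alpha> * (m + u) powr (\<alpha> - 1) - \<alpha> * m powr (\<alpha> - 1)) (at m)"
  unfolding powr_gap_def[abs_def] using assms by (auto intro!: derivative_eq_intros)

lemma powr_gap_mono:
  assumes "1 \<le> \<alpha>" "0 < u" "0 \<le> m" "m \<le> n"
  shows "powr_gap \<alpha> u m \<le> powr_gap \<alpha> u n"
proof (rule DERIV_nonneg_imp_increasing_open[OF \<open>m \<le> n\<close>])
  show "\<exists>y. (powr_gap \<alpha> u has_real_derivative y) (at x) \<and> 0 \<le> y" if "m < x" "x < n" for x
  proof (intro exI conjI)
    show "(powr_gap \<alpha> u has_real_derivative \<alpha> * (x + u) powr (\<alpha> - 1) - \<alpha> * x powr (\<alpha> - 1)) (at x)"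
      using assms that by (intro powr_gap_deriv) auto
    show "0 \<le> \<alpha> * (x + u) powr (\<alpha> - 1) - \<alpha> * x powr (\<alpha> - 1)"
      using assms that by (simp add: mult_left_mono powr_mono2)
  qed
  show "continuous_on {m..n} (powr_gap \<alpha> u)"
    unfolding powr_gap_def[abs_def] using assms by (auto intro!: continuous_intros continuous_on_powr')
qed

text \<open>The quotient is the derivative of \<open>ln (powr_gap \<alpha> u m)\<close> with respect to \<open>ln m\<close>. In terms of
\<open>z = m / (m + u)\<close>, which increases with \<open>m\<close>, it equals \<open>\<alpha> * (1 - (1 - z) / (1 - z powr \<alpha>))\<close>, and the
secant slopes of \<open>z powr \<alpha>\<close> are increasing.\<close>
lemma powr_gap_log_deriv_mono:
  assumes "1 \<le> \<alpha>" "0 < u" "0 < m" "m \<le> n"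
  shows "m * (\<alpha> * (m + u) powr (\<alpha> - 1) - \<alpha> * m powr (\<alpha> - 1)) / powr_gap \<alpha> u m
       \<le> n * (\<alpha> * (n + u) powr (\<alpha> - 1) - \<alpha> * n powr (\<alpha> - 1)) / powr_gap \<alpha> u n"
proof -
  define r where "r z = (1 - z) / (1 - z powr \<alpha>)" for z :: real
  have eq: "x * (\<alpha> * (x + u) powr (\<alpha> - 1) - \<alpha> * x powr (\<alpha> - 1)) / powr_gap \<alpha> u x
      = \<alpha> * (1 - r (x / (x + u)))" if "0 < x" for x
  proof -
    define z where "z = x / (x + u)"
    define s where "s = x + u"
    have z: "0 < z" "z < 1" "x = z * s" and s: "0 < s" using that assms by (auto simp: z_def s_def)
    have za: "z powr \<alpha> < 1" using powr_less_mono2[of \<alpha> z 1] z assms by simp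
    have s1: "s * s powr (\<alpha> - 1) = s powr \<alpha>" "z * z powr (\<alpha> - 1) = z powr \<alpha>"
      using s z by (simp_all add: powr_mult_base)
    have "x * (\<alpha> * (x + u) powr (\<alpha> - 1) - \<alpha> * x powr (\<alpha> - 1))
        = \<alpha> * (z * (s * s powr (\<alpha> - 1)) - (z * z powr (\<alpha> - 1)) * (s * s powr (\<alpha> - 1)))"
      unfolding s_def[symmetric] using z s by (simp add: powr_mult algebra_simps)
    also have "\<dots> = s powr \<alpha> * (\<alpha> * (z - z powr \<alpha>))"
      unfolding s1 by (simp add: algebra_simps)
    finally have num: "x * (\<alpha> * (x + u) powr (\<alpha> - 1) - \<alpha> * x powr (\<alpha> - 1)) = s powr \<alpha> * (\<alpha> * (z - z powr \<alpha>))" .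
    have den: "powr_gap \<alpha> u x = s powr \<alpha> * (1 - z powr \<alpha>)"
      unfolding powr_gap_def s_def[symmetric] using z s by (simp add: powr_mult algebra_simps)
    have "s powr \<alpha> * (\<alpha> * (z - z powr \<alpha>)) / (s powr \<alpha> * (1 - z powr \<alpha>)) = \<alpha> * (z - z powr \<alpha>) / (1 - z powr \<alpha>)"
      using s by simp
    also have "\<dots> = \<alpha> * (1 - r z)"
      using za by (simp add: r_def field_simps)
    finally show ?thesis unfolding num den z_def[symmetric] .
  qed
  define z1 z2 where "z1 = m / (m + u)" and "z2 = n / (n + u)"
  have z: "0 < z1" "z1 \<le> z2" "z2 < 1" using assms by (auto simp: z1_def z2_def field_simps)
  then have "z1 powr \<alpha> < 1" "z2 powr \<alpha> < 1" 
    using powr_less_mono2[of \<alpha> z1 1] powr_less_mono2[of \<alpha> z2 1] assms by auto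
  then have "r z2 \<le> r z1"
    using powr_secant_slope_mono[OF assms(1) z] by (simp add: r_def field_simps)
  then have "\<alpha> * (1 - r z1) \<le> \<alpha> * (1 - r z2)"
    using assms by (intro mult_left_mono) auto
  then show ?thesis using eq assms by (simp add: z1_def z2_def)
qed

text \<open>Convexity of \<open>ln (powr_gap \<alpha> u m)\<close> in \<open>ln m\<close> for the points \<open>p * q\<close>, \<open>p\<close>, \<open>q\<close>, \<open>1\<close>. When \<open>p\<close> or
\<open>q\<close> is 0 the logarithm is not available and monotonicity of the gap suffices.\<close>
lemma powr_gap_mult_convex:
  assumes "1 \<le> \<alpha>" "0 < u" "0 \<le> p" "p \<le> 1" "0 \<le> q" "q \<le> 1"
  shows "powr_gap \<alpha> u p * powr_gap \<alpha> u q \<le> powr_gap \<alpha> u 1 * powr_gap \<alpha> u (p * q)"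
proof (cases "p = 0 \<or> q = 0")
  case True
  have "powr_gap \<alpha> u 0 * powr_gap \<alpha> u x \<le> powr_gap \<alpha> u 1 * powr_gap \<alpha> u 0" if "0 \<le> x" "x \<le> 1" for x
    using powr_gap_mono[of \<alpha> u x 1] powr_gap_pos[of \<alpha> u 0] assms that by (simp add: mult.commute)
  from this[of p] this[of q] show ?thesis using True assms by (auto simp: mult.commute)
next
  case False
  then have p: "0 < p" and q: "0 < q" using assms by auto
  let ?g = "powr_gap \<alpha> u"
  let ?g' = "\<lambda>m. \<alpha> * (m + u) powr (\<alpha> - 1) - \<alpha> * m powr (\<alpha> - 1)"
  have gpos: "0 < ?g x" if "0 < x" for x using powr_gap_pos[of \<alpha> u x] assms that by simp
  define L where "L s = ln (?g s) - ln (?g (s * q))" for s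
  have "L p \<le> L 1"
  proof (rule DERIV_nonneg_imp_nondecreasing[OF \<open>p \<le> 1\<close>])
    fix s assume s: "p \<le> s" "s \<le> 1"
    then have s0: "0 < s" "0 < s * q" "s * q \<le> s" using p q assms by (auto simp: mult_left_le)
    have d2: "((\<lambda>s. ?g (s * q)) has_real_derivative ?g' (s * q) * q) (at s)"
      by (rule DERIV_chain2[of "?g"]) (auto intro!: derivative_eq_intros powr_gap_deriv assms s0)
    have "(L has_real_derivative inverse (?g s) * ?g' s - inverse (?g (s * q)) * (?g' (s * q) * q)) (at s)"
      unfolding L_def[abs_def]
      by (intro DERIV_diff DERIV_chain2[OF DERIV_ln] powr_gap_deriv d2 gpos s0 assms)
    moreover have "0 \<le> s * (inverse (?g s) * ?g' s - inverse (?g (s * q)) * (?g' (s * q) * q))"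
      using powr_gap_log_deriv_mono[OF assms(1,2) s0(2,3)] by (simp add: field_simps)
    then have "0 \<le> inverse (?g s) * ?g' s - inverse (?g (s * q)) * (?g' (s * q) * q)"
      using s0 by (simp add: zero_le_mult_iff)
    ultimately show "\<exists>y. (L has_real_derivative y) (at s) \<and> 0 \<le> y" by blast
  qed
  then have "ln (?g p * ?g q) \<le> ln (?g 1 * ?g (p * q))"
    using gpos[OF p] gpos[OF q] gpos[of 1] gpos[of "p * q"] p q by (simp add: L_def ln_mult less_imp_neq[symmetric])
  then show ?thesis
    using ln_le_cancel_iff[of "?g p * ?g q" "?g 1 * ?g (p * q)"]
      gpos[OF p] gpos[OF q] gpos[of 1] gpos[of "p * q"] p q by simp
qed

text \<open>Homogeneity of the gap reduces the four base points \<open>b d\<close>, \<open>c d\<close>, \<open>b g\<close>, \<open>c g\<close> of a rank one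
matrix with increments \<open>U\<close>, \<open>V\<close>, \<open>W\<close>, \<open>Z\<close> to \<open>1\<close>, \<open>q\<close>, \<open>p\<close>, \<open>p * q\<close> with a common increment, once
\<open>Z\<close> is replaced by its lower bound \<open>V * W / U\<close>; the last two
hypotheses say exactly that \<open>p\<close> and \<open>q\<close> are at most 1.\<close>
lemma powr_gap_det_nonneg:
  assumes \<alpha>: "1 \<le> \<alpha>" and b: "0 < b" and d: "0 < d" and c: "0 \<le> c" and g: "0 \<le> g"
    and nn: "0 \<le> U" "0 \<le> V" "0 \<le> W" "0 \<le> Z" and det: "V * W \<le> U * Z"
    and cU: "c * U \<le> b * V" and gU: "g * U \<le> d * W"
  shows "powr_gap \<alpha> V (c * d) * powr_gap \<alpha> W (b * g) \<le> powr_gap \<alpha> U (b * d) * powr_gap \<alpha> Z (c * g)"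
proof (cases "U = 0 \<or> V = 0 \<or> W = 0")
  case True
  then have "V = 0 \<or> W = 0" using det nn by (auto simp: mult_le_0_iff)
  then have *: "powr_gap \<alpha> V (c * d) * powr_gap \<alpha> W (b * g) = 0" by (auto simp: powr_gap_def)
  show ?thesis unfolding * using assms by (intro mult_nonneg_nonneg powr_gap_nonneg) auto
next
  case False
  then have pos: "0 < U" "0 < V" "0 < W" using nn by auto
  define v w u where "v = V / U" and "w = W / U" and "u = U / (b * d)"
  define p q where "p = g / (d * w)" and "q = c / (b * v)"
  have vw: "0 < v" "0 < w" "0 < u" using pos b d by (auto simp: v_def w_def u_def)
  have pq: "0 \<le> p" "p \<le> 1" "0 \<le> q" "q \<le> 1"
    using pos b d c g cU gU by (auto simp: p_def q_def v_def w_def field_simps)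
  let ?g = "powr_gap \<alpha> u"
  have "powr_gap \<alpha> V (c * d) = powr_gap \<alpha> ((b * d * v) * u) ((b * d * v) * q)"
    using pos b d by (simp add: u_def q_def v_def mult.commute)
  also have "\<dots> = (b * d * v) powr \<alpha> * ?g q"
    using b d vw pq by (intro powr_gap_scale) auto
  finally have 1: "powr_gap \<alpha> V (c * d) = (b * d * v) powr \<alpha> * ?g q" .
  have "powr_gap \<alpha> W (b * g) = powr_gap \<alpha> ((b * d * w) * u) ((b * d * w) * p)"
    using pos b d by (simp add: u_def p_def w_def mult.commute)
  also have "\<dots> = (b * d * w) powr \<alpha> * ?g p"
    using b d vw pq by (intro powr_gap_scale) auto
  finally have 2: "powr_gap \<alpha> W (b * g) = (b * d * w) powr \<alpha> * ?g p" .
  have "powr_gap \<alpha> U (b * d) = powr_gap \<alpha> ((b * d) * u) ((b * d) * 1)"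
    using pos b d by (simp add: u_def)
  also have "\<dots> = (b * d) powr \<alpha> * ?g 1"
    using b d vw pq by (intro powr_gap_scale) auto
  finally have 3: "powr_gap \<alpha> U (b * d) = (b * d) powr \<alpha> * ?g 1" .
  have "V * W / U \<le> Z" using det pos by (simp add: field_simps)
  then have "powr_gap \<alpha> (V * W / U) (c * g) \<le> powr_gap \<alpha> Z (c * g)"
    unfolding powr_gap_def using c g pos \<alpha> by (intro diff_right_mono powr_mono2) auto
  moreover have "powr_gap \<alpha> (V * W / U) (c * g) = powr_gap \<alpha> ((b * d * v * w) * u) ((b * d * v * w) * (p * q))"
    using pos b d by (simp add: u_def p_def q_def v_def w_def field_simps)
  moreover have "\<dots> = (b * d * v * w) powr \<alpha> * ?g (p * q)"
    using b d vw pq by (intro powr_gap_scale) auto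
  ultimately have 4: "(b * d * v * w) powr \<alpha> * ?g (p * q) \<le> powr_gap \<alpha> Z (c * g)" by simp
  have "powr_gap \<alpha> V (c * d) * powr_gap \<alpha> W (b * g) = ((b * d) powr \<alpha> * (b * d * v * w) powr \<alpha>) * (?g p * ?g q)"
    unfolding 1 2 using b d vw by (simp add: powr_mult)
  also have "\<dots> \<le> ((b * d) powr \<alpha> * (b * d * v * w) powr \<alpha>) * (?g 1 * ?g (p * q))"
    by (intro mult_left_mono powr_gap_mult_convex) (use \<alpha> vw pq in auto)
  also have "\<dots> = powr_gap \<alpha> U (b * d) * ((b * d * v * w) powr \<alpha> * ?g (p * q))"
    unfolding 3 by (simp add: algebra_simps)
  also have "\<dots> \<le> powr_gap \<alpha> U (b * d) * powr_gap \<alpha> Z (c * g)"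
    using 4 b d pos \<alpha> by (intro mult_left_mono powr_gap_nonneg) auto
  finally show ?thesis .
qed

lemma powr_det2_mono:
  fixes a b c d \<alpha> :: real
  assumes "0 \<le> a" "0 \<le> b" "0 \<le> c" "0 \<le> d" "0 \<le> \<alpha>" "b * c \<le> a * d"
  shows "b powr \<alpha> * c powr \<alpha> \<le> a powr \<alpha> * d powr \<alpha>"
  using powr_mono2[of \<alpha> "b * c" "a * d"] assms by (simp add: powr_mult)

text \<open>If \<open>a\<close>, \<open>b\<close> and \<open>d\<close> are positive, Sylvester's identity expresses \<open>a\<close> times the determinant through the
\<open>2 \<times> 2\<close> minors containing the corner \<open>a\<close>, for the matrix as well as for its powers, and
\<open>powr_gap_det_nonneg\<close> compares the two. If one of the three vanishes, the \<open>2 \<times> 2\<close> minors force so many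
zeros that the determinant is 0 or \<open>a\<close> times a \<open>2 \<times> 2\<close> minor.\<close>
lemma powr_det3_nonneg:
  fixes a b c d e f g h i \<alpha> :: real
  assumes \<alpha>: "1 \<le> \<alpha>"
    and nn: "0 \<le> a" "0 \<le> b" "0 \<le> c" "0 \<le> d" "0 \<le> e" "0 \<le> f" "0 \<le> g" "0 \<le> h" "0 \<le> i"
    and r12: "b * d \<le> a * e" "c * d \<le> a * f" "c * e \<le> b * f"
    and r13: "b * g \<le> a * h" "c * g \<le> a * i" "c * h \<le> b * i"
    and r23: "e * g \<le> d * h" "f * g \<le> d * i" "f * h \<le> e * i"
    and det: "0 \<le> a * (e * i - f * h) - b * (d * i - f * g) + c * (d * h - e * g)"
  defines "P \<equiv> \<lambda>x. x powr \<alpha>"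
  shows "0 \<le> P a * (P e * P i - P f * P h) - P b * (P d * P i - P f * P g) + P c * (P d * P h - P e * P g)"
proof -
  have P0: "P 0 = 0" and Pnn: "0 \<le> P x" and Pp: "P x = x powr \<alpha>"
    and Pm: "0 \<le> x \<Longrightarrow> 0 \<le> y \<Longrightarrow> P (x * y) = P x * P y" for x y
    by (auto simp: P_def powr_mult)
  have P23: "0 \<le> P e * P i - P f * P h"
    using powr_det2_mono[of e f h i \<alpha>] nn r23 \<alpha> by (simp add: P_def)
  consider "a = 0" | "0 < a" "b = 0" | "0 < a" "d = 0" | "0 < a" "0 < b" "0 < d"
    using nn by fastforce
  then show ?thesis
  proof cases
    case 1
    have "(b = 0 \<or> d = 0) \<and> (b = 0 \<or> g = 0) \<and> (c = 0 \<or> d = 0) \<and> (c = 0 \<or> g = 0)"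
      using r12 r13 nn 1 by (auto simp: mult_le_0_iff)
    then have "b = 0 \<and> c = 0 \<or> d = 0 \<and> g = 0" by auto
    then show ?thesis using 1 P0 by auto
  next
    case 2
    then have "c = 0 \<or> e = 0 \<and> h = 0" using r12 r13 nn by (auto simp: mult_le_0_iff)
    then show ?thesis using 2 P0 Pnn P23 by auto
  next
    case 3
    then have "g = 0 \<or> e = 0 \<and> f = 0" using r23 nn by (auto simp: mult_le_0_iff)
    then show ?thesis using 3 P0 Pnn P23 by auto
  next
    case 4
    have "powr_gap \<alpha> (a * f - c * d) (c * d) * powr_gap \<alpha> (a * h - b * g) (b * g)
        \<le> powr_gap \<alpha> (a * e - b * d) (b * d) * powr_gap \<alpha> (a * i - c * g) (c * g)"
    proof (rule powr_gap_det_nonneg[OF \<alpha> 4(2,3) nn(3,7)])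
      have "0 \<le> a * (a * (e * i - f * h) - b * (d * i - f * g) + c * (d * h - e * g))"
        using det nn by simp
      then show "(a * f - c * d) * (a * h - b * g) \<le> (a * e - b * d) * (a * i - c * g)"
        by (simp add: algebra_simps)
      have "0 \<le> a * (b * f - c * e)" "0 \<le> a * (d * h - e * g)" using r12 r23 nn by simp_all
      then show "c * (a * e - b * d) \<le> b * (a * f - c * d)" "g * (a * e - b * d) \<le> d * (a * h - b * g)"
        by (simp_all add: algebra_simps)
    qed (use r12 r13 in auto)
    then have "(P a * P f - P c * P d) * (P a * P h - P b * P g) \<le> (P a * P e - P b * P d) * (P a * P i - P c * P g)"
      using nn by (simp add: powr_gap_def Pm flip: Pp)
    moreover have "(P a * P e - P b * P d) * (P a * P i - P c * P g) - (P a * P f - P c * P d) * (P a * P h - P b * P g)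
        = P a * (P a * (P e * P i - P f * P h) - P b * (P d * P i - P f * P g) + P c * (P d * P h - P e * P g))"
      by (simp add: algebra_simps)
    moreover have "0 < P a" using 4 by (simp add: P_def)
    ultimately show ?thesis by (metis diff_ge_0_iff_ge zero_le_mult_iff not_less)
  qed
qed

section \<open>Totally nonnegative tridiagonal matrices with negative determinant\<close>

text \<open>The diagonal is \<open>1, 2, ..., 2\<close> with a smaller last entry, chosen so that the
trailing principal minors starting at \<open>a \<ge> 1\<close> are \<open>(a - 1) / (n - 1)\<close>. Thus the minor starting at 1
vanishes and the one starting at 2 is positive; the full determinant is their difference.\<close>
definition tri :: "nat \<Rightarrow> nat \<Rightarrow> nat \<Rightarrow> real" where
  "tri n a b = (if a = b then (if a = 0 then 1 else if Suc a = n then (real n - 2) / (real n - 1) else 2)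
     else if a = Suc b \<or> b = Suc a then 1 else 0)"

lemma tri_minor_neq:
  assumes "sorted_wrt (<) (a # xs)" "sorted_wrt (<) (b # ys)" "length xs = length ys" "a \<noteq> b"
  shows "minor (tri n) (a # xs) (b # ys) = tri n a b * minor (tri n) xs ys"
proof (cases "a < b")
  case True
  then show ?thesis
    using assms by (intro minor_first_row_single) (auto simp: tri_def)
next
  case False
  then show ?thesis
    using assms by (intro minor_first_column_single) (auto simp: tri_def)
qed

lemma tri_minor_uncoupled:
  assumes "sorted_wrt (<) (a # xs)" "sorted_wrt (<) (a # ys)" "length xs = length ys"
    and "Suc a \<notin> set xs \<or> Suc a \<notin> set ys"
  shows "minor (tri n) (a # xs) (a # ys) = tri n a a * minor (tri n) xs ys"
proof (cases "Suc a \<in> set xs")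
  case True
  then show ?thesis
    using assms by (intro minor_first_row_single) (auto simp: tri_def)
next
  case False
  then show ?thesis
    using assms by (intro minor_first_column_single) (auto simp: tri_def)
qed

lemma tri_minor_coupled:
  assumes "sorted_wrt (<) (a # Suc a # xs)" "sorted_wrt (<) (a # Suc a # ys)" "length xs = length ys"
  shows "minor (tri n) (a # Suc a # xs) (a # Suc a # ys) =
    tri n a a * minor (tri n) (Suc a # xs) (Suc a # ys) - minor (tri n) xs ys"
proof -
  have off: "tri n a (Suc a) = 1" "tri n (Suc a) a = 1" by (simp_all add: tri_def)
  have "minor (tri n) (a # Suc a # xs) (a # Suc a # ys) =
    tri n a a * minor (tri n) (Suc a # xs) (Suc a # ys) - tri n a (Suc a) * minor (tri n) (Suc a # xs) (a # ys)"
    using assms by (intro minor_first_row_double) (auto simp: tri_def)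
  also have "minor (tri n) (Suc a # xs) (a # ys) = tri n (Suc a) a * minor (tri n) xs ys"
    using assms by (intro minor_first_column_single) (auto simp: tri_def)
  finally show ?thesis
    unfolding off by simp
qed

lemma sorted_Cons_mem_Suc:
  assumes "sorted_wrt (<) (a # xs)" "Suc a \<in> set xs"
  obtains xs' where "xs = Suc a # xs'"
  using assms by (cases xs) (auto dest: Suc_leI)

text \<open>Unless both tuples start with \<open>a\<close> and \<open>a + 1\<close>, the first row or the first column vanishes away from the
corner. Only the coupled case produces a negative term.\<close>
lemma tri_minor_cases [consumes 3, case_names neq uncoupled coupled]:
  assumes "sorted_wrt (<) (a # xs)" "sorted_wrt (<) (b # ys)" "length xs = length ys"
  obtains (neq) "a \<noteq> b" "minor (tri n) (a # xs) (b # ys) = tri n a b * minor (tri n) xs ys"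
  | (uncoupled) "a = b" "minor (tri n) (a # xs) (b # ys) = tri n a a * minor (tri n) xs ys"
  | (coupled) xs' ys' where "a = b" "xs = Suc a # xs'" "ys = Suc a # ys'"
      "minor (tri n) (a # xs) (b # ys) = tri n a a * minor (tri n) xs ys - minor (tri n) xs' ys'"
proof (cases "a = b")
  case False
  then show ?thesis using neq tri_minor_neq assms by blast
next
  case True
  show ?thesis
  proof (cases "Suc a \<in> set xs \<and> Suc a \<in> set ys")
    case False
    then show ?thesis using uncoupled tri_minor_uncoupled assms True by blast
  next
    case s: True
    then obtain xs' ys' where "xs = Suc a # xs'" "ys = Suc a # ys'"
      using sorted_Cons_mem_Suc assms(1,2) True by metis
    then show ?thesis using coupled[of xs' ys'] tri_minor_coupled[of a xs' ys' n] assms True by simp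
  qed
qed

text \<open>Nonnegativity alone does not survive the subtraction in the coupled case; the lower bound for the ratio to
the minor without the first row and column does, because \<open>2 - (a + 1) / a = (a - 1) / a\<close>. The bound is
attained by trailing principal minors.\<close>
lemma tri_minor_ratio:
  assumes n: "2 \<le> n" and "sorted_wrt (<) xs" "sorted_wrt (<) ys" "length xs = length ys"
    and "set xs \<subseteq> {1..<n}" "set ys \<subseteq> {1..<n}"
  shows "0 \<le> minor (tri n) xs ys \<and> (\<forall>a xs' ys'. xs = a # xs' \<and> ys = a # ys' \<longrightarrow>
    (real a - 1) / real a * minor (tri n) xs' ys' \<le> minor (tri n) xs ys)"
  using assms(2-)
proof (induction xs arbitrary: ys)
  case Nil
  then show ?case by simp
next
  case (Cons a xs)
  then obtain b ys0 where ys: "ys = b # ys0" by (cases ys) auto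
  have a: "1 \<le> a" "a < n" using Cons.prems by auto
  have IH: "0 \<le> minor (tri n) xs ys0" "\<And>a xs' ys'. xs = a # xs' \<Longrightarrow> ys0 = a # ys' \<Longrightarrow>
    (real a - 1) / real a * minor (tri n) xs' ys' \<le> minor (tri n) xs ys0"
    using Cons.IH[of ys0] Cons.prems by (auto simp: ys)
  have daa: "(real a - 1) / real a \<le> tri n a a"
  proof (cases "Suc a = n")
    case True
    then have "real n = real a + 1" by simp
    then show ?thesis using a by (simp add: tri_def)
  next
    case False
    have "(real a - 1) / real a \<le> 2" using a by (simp add: divide_le_eq)
    then show ?thesis using a False by (simp add: tri_def)
  qed
  from Cons.prems have s: "sorted_wrt (<) (a # xs)" "sorted_wrt (<) (b # ys0)" "length xs = length ys0"
    by (simp_all add: ys)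
  from s show ?case
  proof (cases rule: tri_minor_cases[where n = n])
    case neq
    have "0 \<le> tri n a b" using neq(1) by (simp add: tri_def)
    then show ?thesis using neq IH(1) unfolding ys by simp
  next
    case uncoupled
    have "(real a - 1) / real a * minor (tri n) xs ys0 \<le> tri n a a * minor (tri n) xs ys0"
      by (rule mult_right_mono[OF daa IH(1)])
    moreover have "0 \<le> (real a - 1) / real a * minor (tri n) xs ys0"
      using IH(1) a by (intro mult_nonneg_nonneg) auto
    ultimately show ?thesis using uncoupled unfolding ys by auto
  next
    case (coupled xs' ys')
    have "Suc a < n" using Cons.prems(4) coupled by auto
    then have d: "tri n a a = 2" using a by (simp add: tri_def)
    have "real a / (real a + 1) * minor (tri n) xs' ys' \<le> minor (tri n) xs ys0"
      using IH(2)[OF coupled(2,3)] by (simp add: add.commute)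
    then have "minor (tri n) xs' ys' \<le> (real a + 1) / real a * minor (tri n) xs ys0"
      using a by (simp add: field_simps)
    then have "(real a - 1) / real a * minor (tri n) xs ys0 \<le> 2 * minor (tri n) xs ys0 - minor (tri n) xs' ys'"
      using a by (simp add: field_simps)
    moreover have "0 \<le> (real a - 1) / real a * minor (tri n) xs ys0"
      using IH(1) a by (intro mult_nonneg_nonneg) auto
    ultimately show ?thesis using coupled(1,4) d unfolding ys by auto
  qed
qed

text \<open>A tuple starting at \<open>a\<close> with fewer than \<open>n - a\<close> members cannot run through all of \<open>a, ..., n - 1\<close>, so the
coupling breaks before the small last diagonal entry is reached and the ratio stays at least 1. This
compensates the diagonal entry 1 at index 0.\<close>
lemma tri_minor_short:
  assumes n: "2 \<le> n" and "sorted_wrt (<) (a # xs)" "sorted_wrt (<) (a # ys)" "length xs = length ys"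
    and "set (a # xs) \<subseteq> {1..<n}" "set (a # ys) \<subseteq> {1..<n}" "Suc (length xs) < n - a"
  shows "minor (tri n) xs ys \<le> minor (tri n) (a # xs) (a # ys)"
  using assms(2-)
proof (induction xs arbitrary: a ys)
  case Nil
  then show ?case by (simp add: minor_1 tri_def)
next
  case (Cons c xs)
  have d: "tri n a a = 2" using Cons.prems by (simp add: tri_def)
  have nn: "0 \<le> minor (tri n) (c # xs) ys"
    using tri_minor_ratio[OF n, of "c # xs" ys] Cons.prems by auto
  from Cons.prems(1-3) show ?case
  proof (cases rule: tri_minor_cases[where n = n])
    case neq
    then show ?thesis by simp
  next
    case uncoupled
    then show ?thesis using nn d by simp
  next
    case (coupled xs' ys')
    have "minor (tri n) xs' ys' \<le> minor (tri n) (c # xs) ys"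
      using Cons.IH[of "Suc a" ys'] Cons.prems coupled by auto
    then show ?thesis using coupled(4) d by simp
  qed
qed

lemma tri_mem_TN:
  assumes n: "2 \<le> n" and k: "k < enat n"
  shows "tri n \<in> TN k {..<n} {..<n}"
proof (rule TN_memI)
  show "kernel_on {..<n} {..<n} (tri n)"
    using n by (auto simp: kernel_on_def tri_def)
next
  fix r xs ys
  assume r: "2 \<le> r" "enat r \<le> min (ecard {..<n}) (min (ecard {..<n}) k)"
    and xs: "xs \<in> increasing_tuples {..<n} r" and ys: "ys \<in> increasing_tuples {..<n} r"
  have rn: "r < n" using r(2) k by (metis enat_ord_simps(2) min.boundedE order.strict_trans1)
  obtain a xs0 where x: "xs = a # xs0" "length xs0 < n - 1" "sorted_wrt (<) (a # xs0)" "set (a # xs0) \<subseteq> {..<n}"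
    using xs r rn by (cases xs) (auto simp: increasing_tuples_def)
  obtain b ys0 where y: "ys = b # ys0" "sorted_wrt (<) (b # ys0)" "set (b # ys0) \<subseteq> {..<n}" "length xs0 = length ys0"
    using ys xs x r by (cases ys) (auto simp: increasing_tuples_def)
  have tails: "set xs0 \<subseteq> {1..<n}" "set ys0 \<subseteq> {1..<n}" using x y by fastforce+
  have nn: "0 \<le> minor (tri n) xs0 ys0"
    using tri_minor_ratio[OF n, of xs0 ys0] x y tails by auto
  from x(3) y(2,4) have "0 \<le> minor (tri n) (a # xs0) (b # ys0)"
  proof (cases rule: tri_minor_cases[where n = n])
    case neq
    have "0 \<le> tri n a b" using neq by (simp add: tri_def)
    then show ?thesis using neq(2) nn by simp
  next
    case uncoupled
    have "0 \<le> tri n a a" using n by (simp add: tri_def)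
    then show ?thesis using uncoupled nn by simp
  next
    case (coupled xs' ys')
    show ?thesis
    proof (cases "a = 0")
      case False
      then show ?thesis using tri_minor_ratio[OF n x(3) y(2)] x y tails coupled(1) by auto
    next
      case True
      have "minor (tri n) xs' ys' \<le> minor (tri n) (1 # xs') (1 # ys')"
        using x y tails coupled True n by (intro tri_minor_short) auto
      then show ?thesis using coupled True by (simp add: tri_def)
    qed
  qed
  then show "0 \<le> minor (tri n) xs ys" by (simp add: x y)
qed

lemma tri_trailing_minor:
  assumes n: "2 \<le> n" and "1 \<le> a" "a \<le> n"
  shows "minor (tri n) [a..<n] [a..<n] = (real a - 1) / (real n - 1)"
  using assms(3,2)
proof (induction a rule: measure_induct_rule[where f = "\<lambda>a. n - a"])
  case (less a)
  consider "a = n" | "Suc a = n" | "Suc (Suc a) \<le> n" using less.prems by linarith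
  then show ?case
  proof cases
    case 1
    then show ?thesis using n by simp
  next
    case 2
    then show ?thesis using less.prems n by (auto simp: upt_rec minor_1 tri_def)
  next
    case 3
    then have *: "[a..<n] = a # Suc a # [Suc (Suc a)..<n]" "[Suc a..<n] = Suc a # [Suc (Suc a)..<n]"
      by (simp_all add: upt_conv_Cons)
    have "minor (tri n) [a..<n] [a..<n] =
      2 * minor (tri n) [Suc a..<n] [Suc a..<n] - minor (tri n) [Suc (Suc a)..<n] [Suc (Suc a)..<n]"
      unfolding * using 3 less.prems by (subst tri_minor_coupled) (auto simp: tri_def)
    also have "\<dots> = (2 * (real (Suc a) - 1) - (real (Suc (Suc a)) - 1)) / (real n - 1)"
    proof -
      have "minor (tri n) [Suc a..<n] [Suc a..<n] = (real (Suc a) - 1) / (real n - 1)"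
        "minor (tri n) [Suc (Suc a)..<n] [Suc (Suc a)..<n] = (real (Suc (Suc a)) - 1) / (real n - 1)"
        using less.IH[of "Suc a"] less.IH[of "Suc (Suc a)"] 3 less.prems by (simp_all add: diff_less_mono2)
      then show ?thesis by (simp only: diff_divide_distrib right_diff_distrib times_divide_eq_right)
    qed
    also have "2 * (real (Suc a) - 1) - (real (Suc (Suc a)) - 1) = real a - 1" by simp
    finally show ?thesis .
  qed
qed

lemma tri_det_neg:
  assumes n: "2 \<le> n"
  shows "minor (tri n) [0..<n] [0..<n] < 0"
proof -
  have *: "[0..<n] = 0 # Suc 0 # [Suc (Suc 0)..<n]" "[Suc 0..<n] = Suc 0 # [Suc (Suc 0)..<n]"
    using n by (simp_all add: upt_conv_Cons)
  have "minor (tri n) [0..<n] [0..<n] =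
    minor (tri n) [Suc 0..<n] [Suc 0..<n] - minor (tri n) [Suc (Suc 0)..<n] [Suc (Suc 0)..<n]"
    unfolding * using n by (subst tri_minor_coupled) (auto simp: tri_def)
  also have "\<dots> = - 1 / (real n - 1)"
    using tri_trailing_minor[OF n, of "Suc 0"] tri_trailing_minor[OF n, of "Suc (Suc 0)"] n by simp
  finally show ?thesis using n by simp
qed

section \<open>Test matrices of sizes 2, 3 and 4\<close>

definition mat_kernel :: "real list list \<Rightarrow> nat \<Rightarrow> nat \<Rightarrow> real" where
  "mat_kernel rs a b = rs ! a ! b"

lemma less_3_cases: "(a::nat) < 3 \<longleftrightarrow> a = 0 \<or> a = 1 \<or> a = 2"
  by auto

lemma less_4_cases: "(a::nat) < 4 \<longleftrightarrow> a = 0 \<or> a = 1 \<or> a = 2 \<or> a = 3"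
  by auto

lemma increasing_tuples_2: "increasing_tuples X 2 = {[a, b] | a b. a \<in> X \<and> b \<in> X \<and> a < b}"
  by (auto simp: increasing_tuples_def numeral_2_eq_2 length_Suc_conv)

lemma increasing_tuples_3:
  "increasing_tuples X 3 = {[a, b, c] | a b c. a \<in> X \<and> b \<in> X \<and> c \<in> X \<and> a < b \<and> b < c}"
  by (auto simp: increasing_tuples_def numeral_3_eq_3 length_Suc_conv)

lemma increasing_tuples_4:
  "increasing_tuples X 4 =
    {[a, b, c, d] | a b c d. a \<in> X \<and> b \<in> X \<and> c \<in> X \<and> d \<in> X \<and> a < b \<and> b < c \<and> c < d}"
  by (auto simp: increasing_tuples_def eval_nat_numeral length_Suc_conv)

lemma ecard_lessThan: "ecard {..<n::nat} = enat n"
  by (simp add: ecard_def)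

lemma TN_2x2I:
  assumes "\<And>a b. a < 2 \<Longrightarrow> b < 2 \<Longrightarrow> 0 \<le> K a b" and "2 \<le> k \<Longrightarrow> 0 \<le> minor K [0, 1] [0, 1]"
  shows "K \<in> TN k {..<2::nat} {..<2::nat}"
proof (rule TN_memI)
  show "kernel_on {..<2} {..<2} K" using assms(1) by (simp add: kernel_on_def)
next
  fix r xs ys
  assume r: "2 \<le> r" "enat r \<le> min (ecard {..<2::nat}) (min (ecard {..<2::nat}) k)"
    and m: "xs \<in> increasing_tuples {..<2::nat} r" "ys \<in> increasing_tuples {..<2::nat} r"
  have "r = 2" using r by (simp add: ecard_lessThan)
  then have "xs = [0, 1]" "ys = [0, 1]" "2 \<le> k"
    using m r by (auto simp: increasing_tuples_2 numeral_eq_enat)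
  then show "0 \<le> minor K xs ys" using assms(2) by simp
qed

lemma TN_3x3I:
  assumes nn: "\<And>a b. a < 3 \<Longrightarrow> b < 3 \<Longrightarrow> 0 \<le> K a b"
    and 2: "\<And>a b c d. (a, b) \<in> {(0,1), (0,2), (1,2)} \<Longrightarrow> (c, d) \<in> {(0,1), (0,2), (1,2)} \<Longrightarrow> 0 \<le> minor K [a, b] [c, d]"
    and 3: "3 \<le> k \<Longrightarrow> 0 \<le> minor K [0, 1, 2] [0, 1, 2]"
  shows "K \<in> TN k {..<3::nat} {..<3::nat}"
proof (rule TN_memI)
  show "kernel_on {..<3} {..<3} K" using nn by (simp add: kernel_on_def)
next
  fix r xs ys
  assume r: "2 \<le> r" "enat r \<le> min (ecard {..<3::nat}) (min (ecard {..<3::nat}) k)"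
    and m: "xs \<in> increasing_tuples {..<3::nat} r" "ys \<in> increasing_tuples {..<3::nat} r"
  have "r \<le> 3" "enat r \<le> k" using r(2) by (simp_all add: ecard_lessThan)
  moreover have "r = 2 \<or> r = 3" using r(1) \<open>r \<le> 3\<close> by linarith
  ultimately consider "r = 2" | "r = 3" "3 \<le> k" by (auto simp: numeral_eq_enat)
  then show "0 \<le> minor K xs ys"
  proof cases
    case 1
    then show ?thesis
      using m 2 by (fastforce simp: increasing_tuples_2 less_3_cases)
  next
    case r3: 2
    then have "xs = [0, 1, 2]" "ys = [0, 1, 2]"
      using m by (auto simp: increasing_tuples_3)
    then show ?thesis using 3[OF r3(2)] by simp
  qed
qed

lemma TN_4x4I:
  assumes nn: "\<And>a b. a < 4 \<Longrightarrow> b < 4 \<Longrightarrow> 0 \<le> K a b"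
    and 2: "\<And>a b c d. (a, b) \<in> {(0,1), (0,2), (0,3), (1,2), (1,3), (2,3)} \<Longrightarrow>
      (c, d) \<in> {(0,1), (0,2), (0,3), (1,2), (1,3), (2,3)} \<Longrightarrow> 0 \<le> minor K [a, b] [c, d]"
    and 3: "\<And>a b c d e f. (a, b, c) \<in> {(0,1,2), (0,1,3), (0,2,3), (1,2,3)} \<Longrightarrow>
      (d, e, f) \<in> {(0,1,2), (0,1,3), (0,2,3), (1,2,3)} \<Longrightarrow> 0 \<le> minor K [a, b, c] [d, e, f]"
    and 4: "0 \<le> minor K [0, 1, 2, 3] [0, 1, 2, 3]"
  shows "K \<in> TN k {..<4::nat} {..<4::nat}"
proof (rule TN_memI)
  show "kernel_on {..<4} {..<4} K" using nn by (simp add: kernel_on_def)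
next
  fix r xs ys
  assume r: "2 \<le> r" "enat r \<le> min (ecard {..<4::nat}) (min (ecard {..<4::nat}) k)"
    and m: "xs \<in> increasing_tuples {..<4::nat} r" "ys \<in> increasing_tuples {..<4::nat} r"
  consider "r = 2" | "r = 3" | "r = 4" using r by (force simp: ecard_lessThan)
  then show "0 \<le> minor K xs ys"
  proof cases
    case 1
    have "\<exists>a b. zs = [a, b] \<and> (a, b) \<in> {(0,1), (0,2), (0,3), (1,2), (1,3), (2,3)}"
      if "zs \<in> increasing_tuples {..<4::nat} 2" for zs
      using that by (auto simp: increasing_tuples_2 less_4_cases)
    then show ?thesis using m 2 unfolding 1 by metis
  next
    case r3: 2
    have "\<exists>a b c. zs = [a, b, c] \<and> (a, b, c) \<in> {(0,1,2), (0,1,3), (0,2,3), (1,2,3)}"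
      if "zs \<in> increasing_tuples {..<4::nat} 3" for zs
      using that by (auto simp: increasing_tuples_3 less_4_cases)
    then show ?thesis using m 3 unfolding r3 by metis
  next
    case r4: 3
    have "zs = [0, 1, 2, 3]" if "zs \<in> increasing_tuples {..<4::nat} 4" for zs
      using that by (auto simp: increasing_tuples_4)
    then show ?thesis using m 4 unfolding r4 by metis
  qed
qed

text \<open>The entrywise product with the transpose is \<open>band\<close>.\<close>
definition twin :: "nat \<Rightarrow> nat \<Rightarrow> real" where
  "twin = mat_kernel [[1, 1, 0], [1, 1, 1], [1, 1, 1]]"

lemma twin_TN: "twin \<in> TN k {..<3} {..<3}"
  by (rule TN_3x3I) (auto simp: twin_def mat_kernel_def less_3_cases minor_2 minor_3)

text \<open>The determinant is 0; for a function with \<open>\<phi> 0 = 0\<close> and \<open>\<phi> 1 = 1\<close> applied to the entries it becomes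
\<open>\<phi> 2 - 2\<close>.\<close>
definition balanced :: "nat \<Rightarrow> nat \<Rightarrow> real" where
  "balanced = mat_kernel [[1, 1, 0], [1, 2, 1], [0, 1, 1]]"

lemma balanced_TN: "balanced \<in> TN k {..<3} {..<3}"
  by (rule TN_3x3I) (auto simp: balanced_def mat_kernel_def less_3_cases minor_2 minor_3)

text \<open>All minors of size at most 2 are nonnegative, but the determinant is \<open>-1\<close>. The entries are 0 and 1, so
this is unchanged by any function with \<open>\<phi> 0 = 0\<close> and \<open>\<phi> 1 = 1\<close>.\<close>
definition band :: "nat \<Rightarrow> nat \<Rightarrow> real" where
  "band = mat_kernel [[1, 1, 0], [1, 1, 1], [0, 1, 1]]"

lemma band_TN: "k < 3 \<Longrightarrow> band \<in> TN k {..<3} {..<3}"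
  by (rule TN_3x3I) (auto simp: band_def mat_kernel_def less_3_cases minor_2)

text \<open>The entries are \<open>1 + x * b\<close> where the matrix of the \<open>b\<close> is bordered by a zero row and column and its
remaining \<open>3 \<times> 3\<close> block consists of the cumulative sums of the singular totally nonnegative matrix with rows
\<open>1 1 0\<close>, \<open>1 1 1\<close>, \<open>1 1 1\<close>. Singularity removes the term of order \<open>x ^ 3\<close> from the determinant of the powers,
which leaves the sign to the second derivative of the power function.\<close>
definition pencil :: "real \<Rightarrow> nat \<Rightarrow> nat \<Rightarrow> real" where
  "pencil x = mat_kernel [[1, 1, 1, 1], [1, 1 + x, 1 + 2 * x, 1 + 2 * x],
     [1, 1 + 2 * x, 1 + 4 * x, 1 + 5 * x], [1, 1 + 3 * x, 1 + 6 * x, 1 + 8 * x]]"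

lemma pencil_TN: "0 < x \<Longrightarrow> pencil x \<in> TN k {..<4} {..<4}"
  by (rule TN_4x4I)
    (auto simp: pencil_def mat_kernel_def less_4_cases minor_2 minor_3 minor_4 algebra_simps)

lemma powr_second_order:
  assumes "0 < (b::real)" "1 < \<alpha>"
  shows "((\<lambda>x. (((1 + b * x) powr \<alpha> - 1) / (\<alpha> * x) - b) / x) \<longlongrightarrow> (\<alpha> - 1) / 2 * b\<^sup>2) (at_right 0)"
proof -
  have "((\<lambda>x. (((1 + b * x) powr \<alpha> - 1) / (\<alpha> * x) - b) / x) \<longlongrightarrow> b * (b * ((\<alpha> - 1) * \<alpha>)) * inverse \<alpha> / 2) (at_right 0)"
    using assms by real_asymp
  also have "b * (b * ((\<alpha> - 1) * \<alpha>)) * inverse \<alpha> / 2 = (\<alpha> - 1) / 2 * b\<^sup>2"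
    using assms by (simp add: field_simps power2_eq_square)
  finally show ?thesis .
qed

text \<open>Subtracting the first row reduces to the \<open>3 \<times> 3\<close> determinant with entries
\<open>(1 + b * x) powr \<alpha> - 1 = \<alpha> * x * (b + x * r b x)\<close>, where \<open>r b x\<close> tends to \<open>(\<alpha> - 1) / 2 * b\<^sup>2\<close>. Since the matrix
of the \<open>b\<close> is singular, the determinant is \<open>(\<alpha> * x) ^ 3 * x\<close> times an expression \<open>S x + x * Q x + x\<^sup>2 * R x\<close>,
in which \<open>S\<close> is linear in the remainders. In the limit \<open>S\<close> is \<open>(\<alpha> - 1) / 2\<close> times the sum of the three
determinants obtained by squaring one row of the matrix of the \<open>b\<close>, and this sum is \<open>-4\<close>.\<close>
lemma pencil_powr_minor:
  assumes \<alpha>: "1 < \<alpha>"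
  shows "\<exists>x>0. minor (\<lambda>a b. pencil x a b powr \<alpha>) [0, 1, 2, 3] [0, 1, 2, 3] < 0"
proof (rule ccontr)
  assume "\<not> ?thesis"
  then have nn: "0 \<le> minor (\<lambda>a b. pencil x a b powr \<alpha>) [0, 1, 2, 3] [0, 1, 2, 3]" if "0 < x" for x
    using that by force
  define r where "r b x = (((1 + b * x) powr \<alpha> - 1) / (\<alpha> * x) - b) / x" for b x :: real
  define S where "S x = 2 * r 1 x - r 2 x + (4 * r 8 x + 8 * r 4 x - 5 * r 6 x - 6 * r 5 x)
      - 2 * (2 * r 8 x + 8 * r 2 x - 5 * r 3 x - 3 * r 5 x) + 2 * (2 * r 6 x + 6 * r 2 x - 4 * r 3 x - 3 * r 4 x)" for x
  define Q where "Q x = (r 4 x * r 8 x - r 5 x * r 6 x) - 2 * (r 2 x * r 8 x - r 5 x * r 3 x)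
      + 2 * (r 2 x * r 6 x - r 4 x * r 3 x) + r 1 x * (4 * r 8 x + 8 * r 4 x - 5 * r 6 x - 6 * r 5 x)
      - r 2 x * (2 * r 8 x + 8 * r 2 x - 5 * r 3 x - 3 * r 5 x) + r 2 x * (2 * r 6 x + 6 * r 2 x - 4 * r 3 x - 3 * r 4 x)" for x
  define R where "R x = r 1 x * (r 4 x * r 8 x - r 5 x * r 6 x) - r 2 x * (r 2 x * r 8 x - r 5 x * r 3 x)
      + r 2 x * (r 2 x * r 6 x - r 4 x * r 3 x)" for x
  have "0 \<le> S x + x * Q x + x\<^sup>2 * R x" if x: "0 < x" for x
  proof -
    define e where "e b = b + x * r b x" for b
    have pw: "(1 + b * x) powr \<alpha> = 1 + \<alpha> * x * e b" for b
      using x \<alpha> by (simp add: e_def r_def field_simps)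
    have pw1: "(1 + x) powr \<alpha> = 1 + \<alpha> * x * e 1" using pw[of 1] by simp
    have "minor (\<lambda>a b. pencil x a b powr \<alpha>) [0, 1, 2, 3] [0, 1, 2, 3] =
      (\<alpha> * x) ^ 3 * (e 1 * (e 4 * e 8 - e 5 * e 6) - e 2 * (e 2 * e 8 - e 5 * e 3) + e 2 * (e 2 * e 6 - e 4 * e 3))"
      by (simp add: minor_4 minor_3 pencil_def mat_kernel_def pw pw1)
        (simp add: algebra_simps power3_eq_cube)
    also have "e 1 * (e 4 * e 8 - e 5 * e 6) - e 2 * (e 2 * e 8 - e 5 * e 3) + e 2 * (e 2 * e 6 - e 4 * e 3)
      = x * (S x + x * Q x + x\<^sup>2 * R x)"
      unfolding e_def S_def Q_def R_def by (simp add: algebra_simps power2_eq_square power3_eq_cube)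
    finally have "0 \<le> (\<alpha> * x) ^ 3 * (x * (S x + x * Q x + x\<^sup>2 * R x))" using nn[OF x] by simp
    moreover have "0 < (\<alpha> * x) ^ 3 * x" using x \<alpha> by simp
    ultimately show ?thesis
      by (metis mult.assoc mult_less_0_iff not_less zero_less_mult_iff)
  qed
  then have ev: "eventually (\<lambda>x. 0 \<le> S x + x * Q x + x\<^sup>2 * R x) (at_right 0)"
    by (intro eventually_at_right_less[THEN eventually_mono])
  have r: "(r b \<longlongrightarrow> (\<alpha> - 1) / 2 * b\<^sup>2) (at_right 0)" if "0 < b" for b
    unfolding r_def[abs_def] by (rule powr_second_order[OF that \<alpha>])
  define s where "s = (\<alpha> - 1) / 2"
  have lims: "(r 1 \<longlongrightarrow> s) (at_right 0)" "(r 2 \<longlongrightarrow> 4 * s) (at_right 0)" "(r 3 \<longlongrightarrow> 9 * s) (at_right 0)"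
    "(r 4 \<longlongrightarrow> 16 * s) (at_right 0)" "(r 5 \<longlongrightarrow> 25 * s) (at_right 0)" "(r 6 \<longlongrightarrow> 36 * s) (at_right 0)"
    "(r 8 \<longlongrightarrow> 64 * s) (at_right 0)"
    using r[of 1] r[of 2] r[of 3] r[of 4] r[of 5] r[of 6] r[of 8] by (simp_all add: s_def mult.commute)
  have x0: "((\<lambda>x::real. x) \<longlongrightarrow> 0) (at_right 0)" by (rule tendsto_ident_at)
  have "\<exists>q. (Q \<longlongrightarrow> q) (at_right 0)"
    unfolding Q_def[abs_def] by (rule exI, (rule tendsto_intros lims)+)
  then obtain q where q: "(Q \<longlongrightarrow> q) (at_right 0)" ..
  have "\<exists>q. (R \<longlongrightarrow> q) (at_right 0)"
    unfolding R_def[abs_def] by (rule exI, (rule tendsto_intros lims)+)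
  then obtain q' where q': "(R \<longlongrightarrow> q') (at_right 0)" ..
  have S: "(S \<longlongrightarrow> - 4 * s) (at_right 0)"
    unfolding S_def[abs_def] by (rule tendsto_eq_rhs, (rule tendsto_intros lims)+, simp)
  have "((\<lambda>x. S x + x * Q x + x\<^sup>2 * R x) \<longlongrightarrow> - 4 * s + 0 * q + 0\<^sup>2 * q') (at_right 0)"
    by (intro tendsto_intros S q q' x0)
  then have "0 \<le> - 4 * s + 0 * q + 0\<^sup>2 * q'"
    by (rule tendsto_lowerbound[OF _ ev]) simp
  then show False using \<alpha> by (simp add: s_def)
qed

section \<open>Preservers\<close>

lemma const_TN: "0 \<le> c \<Longrightarrow> (\<lambda>_ _. c) \<in> TN k X Y"
proof (rule TN_memI)
  fix r xs ys
  assume r: "2 \<le> (r::nat)" and xs: "xs \<in> increasing_tuples X r" and ys: "ys \<in> increasing_tuples Y r"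
  have "minor (\<lambda>_ _. c) xs ys = 0"
    using r increasing_tuplesD(1)[OF xs] increasing_tuplesD(1)[OF ys]
    by (intro minor_equal_rows[of _ _ 0 1]) auto
  then show "0 \<le> minor (\<lambda>_ _. c) xs ys" by simp
qed (simp add: kernel_on_def)

lemma scale_TN:
  assumes "K \<in> TN k X Y" "0 \<le> c"
  shows "(\<lambda>x y. c * K x y) \<in> TN k X Y"
proof (rule TN_memI)
  show "kernel_on X Y (\<lambda>x y. c * K x y)"
    using assms by (simp add: TN_def kernel_on_def)
next
  fix r xs ys
  assume r: "enat r \<le> min (ecard X) (min (ecard Y) k)"
    and xs: "xs \<in> increasing_tuples X r" and ys: "ys \<in> increasing_tuples Y r"
  then have "0 \<le> minor K xs ys" using TN_minor_nonneg[OF assms(1)] by auto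
  moreover have "minor (\<lambda>x y. c * K x y) xs ys = c ^ length xs * minor K xs ys"
    using increasing_tuplesD(1)[OF xs] increasing_tuplesD(1)[OF ys] by (intro minor_scale) simp
  ultimately show "0 \<le> minor (\<lambda>x y. c * K x y) xs ys" using assms(2) by simp
qed

lemma TN_minor2:
  assumes "K \<in> TN k X Y" "2 \<le> k" "x1 \<in> X" "x2 \<in> X" "x1 < x2" "y1 \<in> Y" "y2 \<in> Y" "y1 < y2"
  shows "K x1 y2 * K x2 y1 \<le> K x1 y1 * K x2 y2"
  using TN_minor_nonneg[OF assms(1), of "[x1, x2]" 2 "[y1, y2]"] assms(2-)
  by (simp add: increasing_tuples_2 minor_2 numeral_eq_enat)

lemma powr_TN3:
  assumes K: "K \<in> TN k X Y" "3 \<le> k" and \<alpha>: "1 \<le> \<alpha>"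
    and small: "min (ecard X) (min (ecard Y) l) \<le> 3"
  shows "(\<lambda>x y. rpow (K x y) \<alpha>) \<in> TN l X Y"
proof (rule TN_memI)
  show "kernel_on X Y (\<lambda>x y. rpow (K x y) \<alpha>)" by (simp add: kernel_on_def rpow_def)
next
  have rp: "rpow t \<alpha> = t powr \<alpha>" for t using \<alpha> by (simp add: rpow_def)
  have k2: "2 \<le> k" using K(2) by (rule order.trans[rotated]) simp
  note m2 = TN_minor2[OF K(1) k2] and nn = TN_nonneg[OF K(1)]
  fix r xs ys
  assume r: "2 \<le> r" "enat r \<le> min (ecard X) (min (ecard Y) l)"
    and xs: "xs \<in> increasing_tuples X r" and ys: "ys \<in> increasing_tuples Y r"
  have "enat r \<le> 3" using r(2) small by (rule order.trans)
  then have "r = 2 \<or> r = 3" using r(1) by (auto simp: numeral_eq_enat)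
  then show "0 \<le> minor (\<lambda>x y. rpow (K x y) \<alpha>) xs ys"
  proof
    assume "r = 2"
    then obtain x1 x2 y1 y2 where *: "xs = [x1, x2]" "ys = [y1, y2]"
      "x1 \<in> X" "x2 \<in> X" "x1 < x2" "y1 \<in> Y" "y2 \<in> Y" "y1 < y2"
      using xs ys by (auto simp: increasing_tuples_2)
    show ?thesis
      using powr_det2_mono[of "K x1 y1" "K x1 y2" "K x2 y1" "K x2 y2" \<alpha>] m2[OF *(3-)] nn * \<alpha>
      by (simp add: minor_2 rp)
  next
    assume "r = 3"
    then obtain x1 x2 x3 y1 y2 y3 where *: "xs = [x1, x2, x3]" "ys = [y1, y2, y3]"
      "x1 \<in> X" "x2 \<in> X" "x3 \<in> X" "x1 < x2" "x2 < x3" "y1 \<in> Y" "y2 \<in> Y" "y3 \<in> Y" "y1 < y2" "y2 < y3"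
      using xs ys by (auto simp: increasing_tuples_3)
    then have lt: "x1 < x3" "y1 < y3" by auto
    have "0 \<le> minor K xs ys"
      using TN_minor_nonneg[OF K(1) xs ys] K(2) \<open>r = 3\<close> by (simp add: numeral_eq_enat)
    then show ?thesis
      unfolding *(1,2) minor_3 rp by (intro powr_det3_nonneg[OF \<alpha>] m2 nn * lt)
  qed
qed

text \<open>For \<open>k\<^sub>j = 1\<close> every nonnegative \<open>2 \<times> 2\<close> matrix is admissible, which is why these coordinates are not
constrained.\<close>
lemma preserver_pairs:
  assumes F: "TN_preserver p X Y k l F" and N: "2 \<le> min (ecard X) (min (ecard Y) l)"
    and t: "a \<in> orthant p" "b \<in> orthant p" "c \<in> orthant p" "d \<in> orthant p"
    and dom: "\<And>j. j \<in> {1..p} \<Longrightarrow> 2 \<le> k j \<Longrightarrow> b j * c j \<le> a j * d j"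
  shows "F b * F c \<le> F a * F d"
proof -
  define A where "A j = mat_kernel [[a j, b j], [c j, d j]]" for j
  have A: "A j \<in> TN (k j) {..<2} {..<2}" if "j \<in> {1..p}" for j
    by (rule TN_2x2I) (use that t dom orthant_nonneg in \<open>auto simp: A_def mat_kernel_def less_2_cases_iff minor_2\<close>)
  have "0 \<le> minor (\<lambda>x y. F (\<lambda>j\<in>{1..p}. A j x y)) [0..<2] [0..<2]"
    using N by (intro preserver_matrix[OF F _ _ A]) (auto simp: numeral_eq_enat)
  moreover have "[0..<2] = [0, 1::nat]" by (simp add: upt_rec)
  ultimately show ?thesis
    using t by (simp add: minor_2 A_def mat_kernel_def orthant_eq_restrict[simplified])
qed

text \<open>Each factor satisfies the inequality for \<open>2 \<times> 2\<close> minors on its own, and such inequalities between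
nonnegative numbers multiply.\<close>
lemma product_form_pairs:
  fixes \<alpha> :: "nat \<Rightarrow> real"
  assumes J: "J \<subseteq> {1..p}" and c: "0 \<le> c" and \<alpha>: "\<forall>j\<in>J. 0 \<le> \<alpha> j"
    and F: "\<forall>t\<in>orthant p. F t =
       c * (\<Prod>j\<in>J. rpow (t j) (\<alpha> j)) * (\<Prod>i\<in>{1..p} - J. if 0 < t i then 1 else 0)"
    and t: "s \<in> orthant p" "t \<in> orthant p" "u \<in> orthant p" "v \<in> orthant p"
    and dom: "\<And>j. j \<in> {1..p} \<Longrightarrow> j \<in> J \<and> \<alpha> j = 0 \<or> t j * u j \<le> s j * v j"
  shows "F t * F u \<le> F s * F v"
proof -
  note nn = orthant_nonneg
  have "(\<Prod>j\<in>J. rpow (t j) (\<alpha> j) * rpow (u j) (\<alpha> j)) \<le> (\<Prod>j\<in>J. rpow (s j) (\<alpha> j) * rpow (v j) (\<alpha> j))"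
  proof (rule prod_mono, intro conjI)
    fix j assume j: "j \<in> J"
    show "0 \<le> rpow (t j) (\<alpha> j) * rpow (u j) (\<alpha> j)" by (simp add: rpow_def)
    show "rpow (t j) (\<alpha> j) * rpow (u j) (\<alpha> j) \<le> rpow (s j) (\<alpha> j) * rpow (v j) (\<alpha> j)"
    proof (cases "\<alpha> j = 0")
      case True
      then show ?thesis by (simp add: rpow_def)
    next
      case False
      moreover have "j \<in> {1..p}" using j J by auto
      ultimately show ?thesis
        using powr_det2_mono[of "s j" "t j" "u j" "v j" "\<alpha> j"] dom[of j] \<alpha> j t nn by (simp add: rpow_def)
    qed
  qed
  moreover have "(\<Prod>i\<in>{1..p} - J. (if 0 < t i then 1 else 0) * (if 0 < u i then 1 else 0 :: real))
      \<le> (\<Prod>i\<in>{1..p} - J. (if 0 < s i then 1 else 0) * (if 0 < v i then 1 else 0))"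
  proof (rule prod_mono, intro conjI)
    fix i assume i: "i \<in> {1..p} - J"
    then have "t i * u i \<le> s i * v i" "0 \<le> s i" "0 \<le> t i" "0 \<le> u i" "0 \<le> v i" using dom[of i] t nn by auto
    then show "(if 0 < t i then 1 else 0) * (if 0 < u i then 1 else 0 :: real)
        \<le> (if 0 < s i then 1 else 0) * (if 0 < v i then 1 else 0)"
    proof (cases "0 < t i \<and> 0 < u i")
      case True
      then have "0 < s i * v i" using \<open>t i * u i \<le> s i * v i\<close> by (meson mult_pos_pos less_le_trans)
      then have "0 < s i" "0 < v i" using \<open>0 \<le> s i\<close> \<open>0 \<le> v i\<close> by (auto simp: zero_less_mult_iff)
      then show ?thesis by simp
    qed auto
  qed auto
  moreover have "0 \<le> (\<Prod>i\<in>{1..p} - J. (if 0 < t i then 1 else 0) * (if 0 < u i then 1 else 0 :: real))"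
    "0 \<le> (\<Prod>j\<in>J. rpow (s j) (\<alpha> j) * rpow (v j) (\<alpha> j))"
    by (intro prod_nonneg; auto simp: rpow_def)+
  ultimately have "c * c * ((\<Prod>j\<in>J. rpow (t j) (\<alpha> j) * rpow (u j) (\<alpha> j)) *
        (\<Prod>i\<in>{1..p} - J. (if 0 < t i then 1 else 0) * (if 0 < u i then 1 else 0)))
      \<le> c * c * ((\<Prod>j\<in>J. rpow (s j) (\<alpha> j) * rpow (v j) (\<alpha> j)) *
        (\<Prod>i\<in>{1..p} - J. (if 0 < s i then 1 else 0) * (if 0 < v i then 1 else 0)))"
    by (intro mult_left_mono mult_mono) auto
  then show ?thesis
    using t by (simp only: F[rule_format] prod.distrib mult_ac)
qed

text \<open>The other variables are fed the constant kernel 1, which is totally nonnegative of every order.\<close>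
lemma single_variable_matrix:
  assumes F: "TN_preserver p X Y k l F" and N: "enat n \<le> min (ecard X) (min (ecard Y) l)" "1 \<le> n"
    and j: "j \<in> {1..p}" and Ff: "\<And>t. t \<in> orthant p \<Longrightarrow> F t = c * f (t j)" and c: "0 < c"
    and B: "B \<in> TN (k j) {..<n} {..<n}"
  shows "0 \<le> minor (\<lambda>x y. f (B x y)) [0..<n] [0..<n]"
proof -
  define A where "A m = (if m = j then B else (\<lambda>_ _. 1))" for m
  have A: "A m \<in> TN (k m) {..<n} {..<n}" for m
    using B const_TN[of 1 "k m" "{..<n}" "{..<n}"] by (simp add: A_def)
  have "0 \<le> minor (\<lambda>x y. F (\<lambda>j\<in>{1..p}. A j x y)) [0..<n] [0..<n]"
    by (rule preserver_matrix[OF F N A])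
  also have "minor (\<lambda>x y. F (\<lambda>j\<in>{1..p}. A j x y)) [0..<n] [0..<n] = minor (\<lambda>x y. c * f (B x y)) [0..<n] [0..<n]"
  proof (rule minor_cong)
    fix a b assume "a < length [0..<n]" "b < length [0..<n]"
    then have ab: "a < n" "b < n" "[0..<n] ! a = a" "[0..<n] ! b = b" by auto
    have "(\<lambda>i\<in>{1..p}. A i a b) \<in> orthant p"
      using TN_nonneg[OF A] ab by (intro orthant_restrict) simp
    then show "F (\<lambda>j\<in>{1..p}. A j ([0..<n] ! a) ([0..<n] ! b)) = c * f (B ([0..<n] ! a) ([0..<n] ! b))"
      using j Ff by (simp add: ab) (simp add: A_def)
  qed auto
  also have "\<dots> = c ^ n * minor (\<lambda>x y. f (B x y)) [0..<n] [0..<n]"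
    by (subst minor_scale) simp_all
  finally show ?thesis using zero_less_power[OF c, of n] by (metis mult_pos_neg not_le)
qed

lemma upt_3: "[0..<3] = [0, 1, 2::nat]" and upt_4: "[0..<4] = [0, 1, 2, 3::nat]"
  by (simp_all add: upt_rec)

text \<open>By \<open>product_form\<close> the function is a product of factors with value 1 at 1; a factor not vanishing at 0 is
constant. The matrices \<open>twin\<close>, \<open>band\<close> and \<open>balanced\<close> restrict the remaining factors.\<close>
lemma preserver_3_power:
  assumes F: "TN_preserver p X Y k l F" and N: "3 \<le> min (ecard X) (min (ecard Y) l)"
    and nonneg: "\<forall>t\<in>orthant p. 0 \<le> F t"
  shows "(\<exists>c\<ge>0. \<forall>t\<in>orthant p. F t = c) \<or>
    (\<exists>j\<in>{1..p}. \<exists>c>0. \<exists>\<alpha>\<ge>1. 3 \<le> k j \<and> (\<forall>t\<in>orthant p. F t = c * rpow (t j) \<alpha>))"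
proof -
  have N2: "2 \<le> min (ecard X) (min (ecard Y) l)" using N by (rule order.trans[rotated]) simp
  have N3: "enat 3 \<le> min (ecard X) (min (ecard Y) l)" using N by (simp add: numeral_eq_enat)
  have "\<forall>a\<in>orthant p. \<forall>b\<in>orthant p. \<forall>c\<in>orthant p. \<forall>d\<in>orthant p.
      (\<forall>j\<in>{1..p}. b j * c j \<le> a j * d j) \<longrightarrow> F b * F c \<le> F a * F d"
    by (intro ballI impI) (rule preserver_pairs[OF F N2]; blast)
  from product_form[of p F "{1..p}", OF nonneg this order.refl]
  obtain J c \<alpha> where J: "J \<subseteq> {1..p}" and c: "0 \<le> c" and \<alpha>: "\<forall>j\<in>J. 0 \<le> \<alpha> j"
    and Fp: "\<forall>t\<in>orthant p. F t =
       c * (\<Prod>j\<in>J. rpow (t j) (\<alpha> j)) * (\<Prod>i\<in>{1..p} - J. if 0 < t i then 1 else 0)"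
    by blast
  define \<phi> where "\<phi> j s = (if j \<in> J then rpow s (\<alpha> j) else if 0 < s then 1 else 0)" for j s
  have Fphi: "F t = c * (\<Prod>j\<in>{1..p}. \<phi> j (t j))" if "t \<in> orthant p" for t
  proof -
    have "(\<Prod>j\<in>{1..p}. \<phi> j (t j)) = (\<Prod>j\<in>{1..p} - J. \<phi> j (t j)) * (\<Prod>j\<in>J. \<phi> j (t j))"
      using J by (intro prod.subset_diff) auto
    also have "\<dots> = (\<Prod>i\<in>{1..p} - J. if 0 < t i then 1 else 0) * (\<Prod>j\<in>J. rpow (t j) (\<alpha> j))"
      by (intro arg_cong2[where f = "(*)"] prod.cong) (auto simp: \<phi>_def)
    finally show ?thesis using Fp that by simp
  qed
  have phi1: "\<phi> j 1 = 1" for j by (simp add: \<phi>_def rpow_def)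
  define S where "S = {j \<in> {1..p}. \<phi> j 0 = 0}"
  have inactive: "\<phi> j s = 1" if "j \<in> {1..p}" "j \<notin> S" "0 \<le> s" for j s
    using that by (auto simp: S_def \<phi>_def rpow_def split: if_splits)
  have FS: "F t = c * (\<Prod>j\<in>S. \<phi> j (t j))" if t: "t \<in> orthant p" for t
  proof -
    have "(\<Prod>j\<in>{1..p}. \<phi> j (t j)) = (\<Prod>j\<in>S. \<phi> j (t j))"
    proof (rule prod.mono_neutral_right)
      show "\<forall>j\<in>{1..p} - S. \<phi> j (t j) = 1"
        using inactive orthant_nonneg[OF t] by blast
    qed (auto simp: S_def)
    then show ?thesis by (simp add: Fphi[OF t])
  qed
  consider "c = 0 \<or> S = {}" | i j where "0 < c" "i \<in> S" "j \<in> S" "i \<noteq> j" | j where "0 < c" "S = {j}"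
  proof (cases "c = 0 \<or> S = {}")
    case False
    then obtain j where "0 < c" "j \<in> S" using c by auto
    then show ?thesis using that(2,3) by (cases "S = {j}") auto
  qed (use that(1) in blast)
  then show ?thesis
  proof cases
    case 1
    then have "\<forall>t\<in>orthant p. F t = c" using FS by auto
    then show ?thesis using c by blast
  next
    case (2 i j)
    have ij: "i \<in> {1..p}" "j \<in> {1..p}" "\<phi> i 0 = 0" "\<phi> j 0 = 0" using 2 by (auto simp: S_def)
    define A where "A m = (if m = i then twin else if m = j then (\<lambda>a b. twin b a) else (\<lambda>_ _. 1))" for m
    have A: "A m \<in> TN (k m) {..<3} {..<3}" for m
      by (simp add: A_def twin_TN TN_transpose[OF twin_TN] const_TN)
    have "0 \<le> minor (\<lambda>x y. F (\<lambda>j\<in>{1..p}. A j x y)) [0..<3] [0..<3]"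
      by (rule preserver_matrix[OF F N3 _ A]) simp
    also have "minor (\<lambda>x y. F (\<lambda>j\<in>{1..p}. A j x y)) [0..<3] [0..<3] = minor (\<lambda>x y. c * band x y) [0..<3] [0..<3]"
    proof (rule minor_cong)
      fix a b assume "a < length [0..<3]" "b < length [0..<3]"
      then have ab: "a < 3" "b < 3" "[0..<3] ! a = a" "[0..<3] ! b = b" by auto
      let ?t = "\<lambda>m\<in>{1..p}. A m a b"
      have "?t \<in> orthant p"
        using TN_nonneg[OF A] ab by (intro orthant_restrict) simp
      then have "F ?t = c * (\<Prod>m\<in>{1..p}. \<phi> m (A m a b))" by (simp add: Fphi)
      also have "(\<Prod>m\<in>{1..p}. \<phi> m (A m a b)) = (\<Prod>m\<in>{i, j}. \<phi> m (A m a b))"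
        using ij by (intro prod.mono_neutral_right) (auto simp: A_def phi1)
      also have "\<dots> = \<phi> i (twin a b) * \<phi> j (twin b a)"
        using \<open>i \<noteq> j\<close> by (simp add: A_def)
      also have "\<dots> = band a b"
        using ab(1,2) ij phi1 by (auto simp: less_3_cases twin_def band_def mat_kernel_def)
      finally show "F (\<lambda>m\<in>{1..p}. A m ([0..<3] ! a) ([0..<3] ! b)) = c * band ([0..<3] ! a) ([0..<3] ! b)"
        by (simp only: ab)
    qed auto
    also have "\<dots> = c ^ 3 * minor band [0..<3] [0..<3]"
      by (subst minor_scale) simp_all
    also have "\<dots> < 0"
      using 2 by (simp add: upt_3 minor_3 band_def mat_kernel_def)
    finally show ?thesis by simp
  next
    case (3 j)
    have j: "j \<in> {1..p}" "\<phi> j 0 = 0" using 3 by (auto simp: S_def)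
    have Fj: "F t = c * \<phi> j (t j)" if "t \<in> orthant p" for t
      using FS[OF that] 3 by simp
    have k3: "3 \<le> k j"
    proof (rule ccontr)
      assume "\<not> 3 \<le> k j"
      then have "0 \<le> minor (\<lambda>x y. \<phi> j (band x y)) [0..<3] [0..<3]"
        by (intro single_variable_matrix[OF F N3 _ j(1) Fj 3(1)] band_TN) auto
      then show False using j phi1 by (simp add: upt_3 minor_3 band_def mat_kernel_def)
    qed
    have "0 \<le> minor (\<lambda>x y. \<phi> j (balanced x y)) [0..<3] [0..<3]"
      by (intro single_variable_matrix[OF F N3 _ j(1) Fj 3(1)] balanced_TN) auto
    then have phi2: "2 \<le> \<phi> j 2" using j phi1 by (simp add: upt_3 minor_3 balanced_def mat_kernel_def)
    have jJ: "j \<in> J" using phi2 by (auto simp: \<phi>_def split: if_splits)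
    then have "2 powr 1 \<le> 2 powr \<alpha> j" using phi2 by (simp add: \<phi>_def rpow_def)
    then have "1 \<le> \<alpha> j" using powr_le_cancel_iff[of 2 1 "\<alpha> j"] by simp
    moreover have "\<forall>t\<in>orthant p. F t = c * rpow (t j) (\<alpha> j)"
      using Fj jJ by (simp add: \<phi>_def)
    ultimately show ?thesis using k3 j(1) 3(1) by blast
  qed
qed

text \<open>The matrices \<open>pencil x\<close> leave only the exponent 1. If the order of the active variable were a finite \<open>m\<close>
less than the minimum, then \<open>tri (m + 1)\<close> would be an admissible argument.\<close>
lemma preserver_4_linear:
  assumes F: "TN_preserver p X Y k l F" and N: "4 \<le> min (ecard X) (min (ecard Y) l)"
    and nonneg: "\<forall>t\<in>orthant p. 0 \<le> F t"
  shows "(\<exists>c\<ge>0. \<forall>t\<in>orthant p. F t = c) \<or>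
    (\<exists>j\<in>{1..p}. \<exists>c>0. min (ecard X) (min (ecard Y) l) \<le> k j \<and> (\<forall>t\<in>orthant p. F t = c * t j))"
proof -
  have N3: "3 \<le> min (ecard X) (min (ecard Y) l)" using N by (rule order.trans[rotated]) simp
  have N4: "enat 4 \<le> min (ecard X) (min (ecard Y) l)" using N by (simp add: numeral_eq_enat)
  from preserver_3_power[OF F N3 nonneg] show ?thesis
  proof
    assume "\<exists>j\<in>{1..p}. \<exists>c>0. \<exists>\<alpha>\<ge>1. 3 \<le> k j \<and> (\<forall>t\<in>orthant p. F t = c * rpow (t j) \<alpha>)"
    then obtain j c \<alpha> where j: "j \<in> {1..p}" and c: "0 < c" and \<alpha>: "1 \<le> \<alpha>" and k3: "3 \<le> k j"
      and Fj: "\<And>t. t \<in> orthant p \<Longrightarrow> F t = c * rpow (t j) \<alpha>" by blast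
    have "\<alpha> = 1"
    proof (rule ccontr)
      assume "\<alpha> \<noteq> 1"
      then have "1 < \<alpha>" using \<alpha> by simp
      from pencil_powr_minor[OF this] obtain x where x: "0 < x"
        "minor (\<lambda>a b. pencil x a b powr \<alpha>) [0, 1, 2, 3] [0, 1, 2, 3] < 0" by blast
      have "0 \<le> minor (\<lambda>a b. rpow (pencil x a b) \<alpha>) [0..<4] [0..<4]"
        by (intro single_variable_matrix[OF F N4 _ j Fj c] pencil_TN x) auto
      then show False using x(2) \<alpha> by (simp add: upt_4 rpow_def)
    qed
    then have lin: "F t = c * t j" if "t \<in> orthant p" for t
      using Fj[OF that] orthant_nonneg[OF that j] by (simp add: rpow_def)
    have "min (ecard X) (min (ecard Y) l) \<le> k j"
    proof (rule ccontr)
      assume less: "\<not> min (ecard X) (min (ecard Y) l) \<le> k j"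
      then obtain m where m: "k j = enat m" by (cases "k j") auto
      have n: "enat (Suc m) \<le> min (ecard X) (min (ecard Y) l)"
        using less unfolding m not_le by (metis Suc_ile_eq)
      have "3 \<le> m" using k3 by (simp add: m numeral_eq_enat)
      then have "0 \<le> minor (\<lambda>a b. tri (Suc m) a b) [0..<Suc m] [0..<Suc m]"
        by (intro single_variable_matrix[OF F n _ j lin c] tri_mem_TN) (auto simp: m)
      then show False using tri_det_neg[of "Suc m"] \<open>3 \<le> m\<close> by simp
    qed
    then show ?thesis using j c lin by blast
  qed (rule disjI1)
qed

theorem theorem1p4:
  fixes X :: "'a::linorder set" and Y :: "'b::linorder set"
    and p :: nat and k :: "nat \<Rightarrow> enat" and l N :: enat
    and F :: "(nat \<Rightarrow> real) \<Rightarrow> real"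
  assumes "X \<noteq> {}" and "Y \<noteq> {}" and "1 \<le> p"
    and "\<And>j. j \<in> {1..p} \<Longrightarrow> 1 \<le> k j" and "1 \<le> l"
    and "N = min (ecard X) (min (ecard Y) l)"
    and "F \<in> orthant p \<rightarrow> {0..}"
  shows "(N = 1 \<longrightarrow> TN_preserver p X Y k l F) \<and>
    (N = 2 \<longrightarrow>
       (TN_preserver p X Y k l F \<longleftrightarrow>
         (\<exists>J\<subseteq>{1..p}. \<exists>c\<ge>0. \<exists>\<alpha> :: nat \<Rightarrow> real.
            (\<forall>j\<in>J. 0 \<le> \<alpha> j) \<and>
            (\<forall>t\<in>orthant p. F t =
               c * (\<Prod>j\<in>J. rpow (t j) (\<alpha> j)) * (\<Prod>i\<in>{1..p} - J. if 0 < t i then 1 else 0)) \<and>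
            (\<forall>j\<in>{1..p}. k j < N \<longrightarrow> j \<in> J \<and> \<alpha> j = 0)))) \<and>
    (N = 3 \<longrightarrow>
       (TN_preserver p X Y k l F \<longleftrightarrow>
         (\<exists>c\<ge>0. \<forall>t\<in>orthant p. F t = c) \<or>
         (\<exists>j\<in>{1..p}. \<exists>c>0. \<exists>\<alpha>\<ge>1. N \<le> k j \<and>
            (\<forall>t\<in>orthant p. F t = c * rpow (t j) \<alpha>)))) \<and>
    (4 \<le> N \<longrightarrow>
       (TN_preserver p X Y k l F \<longleftrightarrow>
         (\<exists>c\<ge>0. \<forall>t\<in>orthant p. F t = c) \<or>
         (\<exists>j\<in>{1..p}. \<exists>c>0. N \<le> k j \<and> (\<forall>t\<in>orthant p. F t = c * t j))))"
proof -
  note N = assms(6)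
  have nonneg: "\<forall>t\<in>orthant p. 0 \<le> F t" using assms(7) by auto
  have entries: "(\<lambda>j\<in>{1..p}. K j x y) \<in> orthant p"
    if "\<forall>j\<in>{1..p}. K j \<in> TN (k j) X Y" "x \<in> X" "y \<in> Y" for K x y
    using that TN_nonneg by (intro orthant_restrict) blast
  have preserverI: "TN_preserver p X Y k l F"
    if minor_nonneg: "\<And>K r xs ys. \<forall>j\<in>{1..p}. K j \<in> TN (k j) X Y \<Longrightarrow> 2 \<le> r \<Longrightarrow> enat r \<le> N \<Longrightarrow>
      xs \<in> increasing_tuples X r \<Longrightarrow> ys \<in> increasing_tuples Y r \<Longrightarrow> 0 \<le> minor (compose_kernels p F K) xs ys"
    unfolding TN_preserver_def
  proof (intro allI impI TN_memI)
    fix K assume K: "\<forall>j\<in>{1..p}. K j \<in> TN (k j) X Y"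
    show "kernel_on X Y (compose_kernels p F K)"
      using nonneg entries[OF K] by (simp add: kernel_on_def compose_kernels_def)
    show "0 \<le> minor (compose_kernels p F K) xs ys"
      if "2 \<le> r" "enat r \<le> min (ecard X) (min (ecard Y) l)"
        "xs \<in> increasing_tuples X r" "ys \<in> increasing_tuples Y r" for r xs ys
      using minor_nonneg[OF K that(1) _ that(3,4)] that(2) N by simp
  qed
  have const: "TN_preserver p X Y k l F" if ex: "\<exists>c\<ge>0. \<forall>t\<in>orthant p. F t = c"
  proof -
    obtain c where c: "0 \<le> c" "\<And>t. t \<in> orthant p \<Longrightarrow> F t = c" using ex by blast
    show ?thesis
    proof (rule preserverI)
      fix K r xs ys
      assume K: "\<forall>j\<in>{1..p}. K j \<in> TN (k j) X Y" and r: "enat r \<le> N"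
        and xs: "xs \<in> increasing_tuples X r" and ys: "ys \<in> increasing_tuples Y r"
      have "minor (compose_kernels p F K) xs ys = minor (\<lambda>_ _. c) xs ys"
        using increasing_tuplesD(1,2)[OF xs] increasing_tuplesD(1,2)[OF ys]
        by (intro minor_cong) (auto simp: compose_kernels_def intro!: c(2) entries[OF K, simplified])
      then show "0 \<le> minor (compose_kernels p F K) xs ys"
        using TN_minor_nonneg[OF const_TN[OF c(1)] xs ys, of \<infinity>] by simp
    qed
  qed
  have single: "TN_preserver p X Y k l F"
    if j: "j \<in> {1..p}" and c: "0 < c" and Fj: "\<forall>t\<in>orthant p. F t = c * f (t j)"
      and f: "\<And>K. K \<in> TN (k j) X Y \<Longrightarrow> (\<lambda>x y. f (K x y)) \<in> TN N X Y" for j c f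
  proof (rule preserverI)
    fix K r xs ys
    assume K: "\<forall>j\<in>{1..p}. K j \<in> TN (k j) X Y" and r: "enat r \<le> N"
      and xs: "xs \<in> increasing_tuples X r" and ys: "ys \<in> increasing_tuples Y r"
    have "compose_kernels p F K x y = c * f (K j x y)" if "x \<in> X" "y \<in> Y" for x y
      using Fj entries[OF K that] j by (simp add: compose_kernels_def)
    then have "minor (compose_kernels p F K) xs ys = minor (\<lambda>x y. c * f (K j x y)) xs ys"
      using increasing_tuplesD(1,2)[OF xs] increasing_tuplesD(1,2)[OF ys]
      by (intro minor_cong) (auto simp: subset_iff)
    moreover have "(\<lambda>x y. c * f (K j x y)) \<in> TN N X Y"
      using K j c by (intro scale_TN f) auto
    ultimately show "0 \<le> minor (compose_kernels p F K) xs ys"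
      using TN_minor_nonneg[OF _ xs ys r] by simp
  qed
  have "TN_preserver p X Y k l F" if "N = 1"
    by (rule preserverI) (use that in \<open>auto simp: one_enat_def\<close>)
  moreover have "TN_preserver p X Y k l F \<longleftrightarrow>
         (\<exists>J\<subseteq>{1..p}. \<exists>c\<ge>0. \<exists>\<alpha> :: nat \<Rightarrow> real.
            (\<forall>j\<in>J. 0 \<le> \<alpha> j) \<and>
            (\<forall>t\<in>orthant p. F t =
               c * (\<Prod>j\<in>J. rpow (t j) (\<alpha> j)) * (\<Prod>i\<in>{1..p} - J. if 0 < t i then 1 else 0)) \<and>
            (\<forall>j\<in>{1..p}. k j < N \<longrightarrow> j \<in> J \<and> \<alpha> j = 0))" (is "_ \<longleftrightarrow> ?form")
    if N2: "N = 2"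
  proof
    assume F: "TN_preserver p X Y k l F"
    have N2': "2 \<le> min (ecard X) (min (ecard Y) l)" using N N2 by simp
    let ?S = "{j \<in> {1..p}. 2 \<le> k j}"
    have "\<forall>a\<in>orthant p. \<forall>b\<in>orthant p. \<forall>c\<in>orthant p. \<forall>d\<in>orthant p.
        (\<forall>j\<in>?S. b j * c j \<le> a j * d j) \<longrightarrow> F b * F c \<le> F a * F d"
      by (intro ballI impI) (rule preserver_pairs[OF F N2']; blast)
    from product_form[OF nonneg this Collect_restrict]
    obtain J c and \<alpha> :: "nat \<Rightarrow> real" where *: "J \<subseteq> {1..p}" "0 \<le> c" "\<forall>j\<in>J. 0 \<le> \<alpha> j"
       "\<forall>t\<in>orthant p. F t =
               c * (\<Prod>j\<in>J. rpow (t j) (\<alpha> j)) * (\<Prod>i\<in>{1..p} - J. if 0 < t i then 1 else 0)"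
       "\<forall>j\<in>{1..p} - ?S. j \<in> J \<and> \<alpha> j = 0"
      by blast
    have "\<forall>j\<in>{1..p}. k j < N \<longrightarrow> j \<in> J \<and> \<alpha> j = 0"
      using *(5) N2 by auto
    then show ?form using *(1-4) by blast
  next
    assume ?form
    then obtain J c and \<alpha> :: "nat \<Rightarrow> real" where *: "J \<subseteq> {1..p}" "0 \<le> c" "\<forall>j\<in>J. 0 \<le> \<alpha> j"
       "\<forall>t\<in>orthant p. F t =
               c * (\<Prod>j\<in>J. rpow (t j) (\<alpha> j)) * (\<Prod>i\<in>{1..p} - J. if 0 < t i then 1 else 0)"
      and inactive: "\<forall>j\<in>{1..p}. k j < N \<longrightarrow> j \<in> J \<and> \<alpha> j = 0"
      by blast
    show "TN_preserver p X Y k l F"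
    proof (rule preserverI)
      fix K r xs ys
      assume K: "\<forall>j\<in>{1..p}. K j \<in> TN (k j) X Y" and r: "2 \<le> r" "enat r \<le> N"
        and xs: "xs \<in> increasing_tuples X r" and ys: "ys \<in> increasing_tuples Y r"
      have "r = 2" using r N2 by (simp add: numeral_eq_enat)
      then obtain x1 x2 y1 y2 where xy: "xs = [x1, x2]" "ys = [y1, y2]"
        "x1 \<in> X" "x2 \<in> X" "x1 < x2" "y1 \<in> Y" "y2 \<in> Y" "y1 < y2"
        using xs ys by (auto simp: increasing_tuples_2)
      let ?t = "\<lambda>x y. \<lambda>j\<in>{1..p}. K j x y"
      have "F (?t x1 y2) * F (?t x2 y1) \<le> F (?t x1 y1) * F (?t x2 y2)"
      proof (rule product_form_pairs[OF *])
        fix j assume j: "j \<in> {1..p}"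
        show "j \<in> J \<and> \<alpha> j = 0 \<or> ?t x1 y2 j * ?t x2 y1 j \<le> ?t x1 y1 j * ?t x2 y2 j"
        proof (cases "k j < N")
          case True
          then show ?thesis using inactive j by blast
        next
          case False
          then show ?thesis
            using TN_minor2[of "K j" "k j" X Y x1 x2 y1 y2] K j xy N2 by simp
        qed
      qed (intro entries[OF K] xy)+
      then show "0 \<le> minor (compose_kernels p F K) xs ys"
        by (simp add: xy minor_2 compose_kernels_def)
    qed
  qed
  moreover have "TN_preserver p X Y k l F \<longleftrightarrow>
         (\<exists>c\<ge>0. \<forall>t\<in>orthant p. F t = c) \<or>
         (\<exists>j\<in>{1..p}. \<exists>c>0. \<exists>\<alpha>\<ge>1. N \<le> k j \<and>
            (\<forall>t\<in>orthant p. F t = c * rpow (t j) \<alpha>))" (is "_ \<longleftrightarrow> ?form") if N3: "N = 3"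
  proof
    assume "TN_preserver p X Y k l F"
    moreover have "3 \<le> min (ecard X) (min (ecard Y) l)" using N N3 by simp
    ultimately show ?form unfolding N3 by (rule preserver_3_power[OF _ _ nonneg])
  next
    assume ?form
    then show "TN_preserver p X Y k l F"
    proof
      assume "\<exists>j\<in>{1..p}. \<exists>c>0. \<exists>\<alpha>\<ge>1. N \<le> k j \<and> (\<forall>t\<in>orthant p. F t = c * rpow (t j) \<alpha>)"
      then obtain j c \<alpha> where *: "j \<in> {1..p}" "0 < c" "1 \<le> \<alpha>" "N \<le> k j"
        "\<forall>t\<in>orthant p. F t = c * rpow (t j) \<alpha>" by blast
      show ?thesis
      proof (rule single[OF *(1,2,5)])
        fix K assume "K \<in> TN (k j) X Y"
        then show "(\<lambda>x y. rpow (K x y) \<alpha>) \<in> TN N X Y"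
          using *(3,4) N3 by (intro powr_TN3[of K "k j"]) (auto simp: min.coboundedI2)
      qed
    qed (rule const)
  qed
  moreover have "TN_preserver p X Y k l F \<longleftrightarrow>
         (\<exists>c\<ge>0. \<forall>t\<in>orthant p. F t = c) \<or>
         (\<exists>j\<in>{1..p}. \<exists>c>0. N \<le> k j \<and> (\<forall>t\<in>orthant p. F t = c * t j))" (is "_ \<longleftrightarrow> ?form") if N4: "4 \<le> N"
  proof
    assume "TN_preserver p X Y k l F"
    from preserver_4_linear[OF this _ nonneg] N4 show ?form unfolding N by simp
  next
    assume ?form
    then show "TN_preserver p X Y k l F"
    proof
      assume "\<exists>j\<in>{1..p}. \<exists>c>0. N \<le> k j \<and> (\<forall>t\<in>orthant p. F t = c * t j)"
      then obtain j c where *: "j \<in> {1..p}" "0 < c" "\<forall>t\<in>orthant p. F t = c * t j" and k: "N \<le> k j" by blast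
      show ?thesis
      proof (rule single[where f = "\<lambda>t. t", OF *])
        fix K assume "K \<in> TN (k j) X Y"
        then show "(\<lambda>x y. K x y) \<in> TN N X Y"
          using k unfolding TN_def by (auto intro: order.trans)
      qed
    qed (rule const)
  qed
  ultimately show ?thesis by blast
qed

end
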